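(* Let $G$ be a countable discrete infinite amenable group, let $(X,G)$ be a $G$-system and let $\mathcal{U}$ be a finite open cover of $X$. Then the function $\mathcal{M}(X,G)\to[0,+\infty)$, $\mu\mapsto h_\mu(G,\mathcal{U})$, is upper semi-continuous on $\mathcal{M}(X,G)$.
   Context: Let $F(G)$ be the set of non-empty finite subsets of $G$. A sequence $\{F_n\}_{n\in\mathbb{N}}\subseteq F(G)$ is a Følner sequence if for all $K\in F(G)$ and $\delta>0$ one has $|K^{-1}F_n\cap K^{-1}(G\setminus F_n)|<\delta|F_n|$ for all large $n$. A $G$-system $(X,G)$ is a compact metric space $X$ with a continuous action $G\times X\to X$. $\mathcal{M}(X,G)$ is the set of $G$-invariant Borel probability measures on $X$ with the weak$^*$-topology. A cover of $X$ is a finite family of Borel sets with union $X$; a partition is a cover with pairwise disjoint elements; $\mathcal{P}_X$ is the set of partitions. For covers, $\mathcal{U}\succeq\mathcal{V}$ means each element of $\mathcal{U}$ is contained in some element of $\mathcal{V}$, and $\mathcal{U}\vee\mathcal{V}=\{U\cap V:U\in\mathcal{U},V\in\mathcal{V}\}$. For $F\in F(G)$, $\mathcal{U}_F=\bigvee_{g\in F}g^{-1}\mathcal{U}$. For $\mu\in\mathcal{M}(X,G)$ and $\alpha\in\mathcal{P}_X$, $H_\mu(\alpha)=\sum_{A\in\alpha}-\mu(A)\log\mu(A)$ and $h_\mu(G,\alpha)=\lim_{n\to+\infty}\frac{1}{|F_n|}H_\mu(\alpha_{F_n})$; the limit exists and does not depend on the Følner sequence $\{F_n\}$. For a cover $\mathcal{U}$,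 $h_\mu(G,\mathcal{U})=\inf\{h_\mu(G,\alpha):\alpha\in\mathcal{P}_X,\ \alpha\succeq\mathcal{U}\}$. *)

theory Defs
  imports
    "HOL-Analysis.Analysis"
    "HOL-Probability.Probability_Measure"
    "HOL-Algebra.Group_Action"
begin

definition folner_sequence :: "('g, 'm) monoid_scheme \<Rightarrow> (nat \<Rightarrow> 'g set) \<Rightarrow> bool" where
  "folner_sequence G F \<longleftrightarrow>
     (\<forall>n. F n \<subseteq> carrier G \<and> finite (F n) \<and> F n \<noteq> {}) \<and>
     (\<forall>K \<delta>. K \<subseteq> carrier G \<and> finite K \<and> K \<noteq> {} \<and> (0::real) < \<delta> \<longrightarrow>
        (\<forall>\<^sub>F n in sequentially.
           real (card (((set_inv\<^bsub>G\<^esub> K) <#>\<^bsub>G\<^esub> F n) \<inter> ((set_inv\<^bsub>G\<^esub> K) <#>\<^bsub>G\<^esub> (carrier G - F n))))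
             < \<delta> * real (card (F n))))"

(* Amenability in the sense of Folner; meant for countable discrete groups only, since it forces
   countability. *)
definition amenable :: "('g, 'm) monoid_scheme \<Rightarrow> bool" where
  "amenable G \<longleftrightarrow> (\<exists>F. folner_sequence G F)"

(* The compact metric space X is the whole type 'x; g acts on X by the map \<phi> g.  The group
   carries the discrete topology. *)
locale G_system = group_action G UNIV \<phi>
  for G :: "('g, 'm) monoid_scheme" (structure) and \<phi> :: "'g \<Rightarrow> 'x::metric_space \<Rightarrow> 'x" +
  assumes compact_space: "compact (UNIV :: 'x set)"
    and continuous_action:
      "continuous_map (prod_topology (discrete_topology (carrier G)) euclidean) euclidean
         (\<lambda>(g, x). \<phi> g x)"

definition invariant_measures ::
    "('g, 'm) monoid_scheme \<Rightarrow> ('g \<Rightarrow> 'x::metric_space \<Rightarrow> 'x) \<Rightarrow> 'x measure set" where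
  "invariant_measures G \<phi> =
     {\<mu>. prob_space \<mu> \<and> sets \<mu> = sets borel \<and> (\<forall>g\<in>carrier G. distr \<mu> borel (\<phi> g) = \<mu>)}"

(* The coarsest topology on the set M of measures for which every map \<mu> \<mapsto> \<integral> f d\<mu> with f continuous
   is continuous; boundedness of f is automatic, as X is compact. *)
definition weak_star_topology :: "'x::metric_space measure set \<Rightarrow> 'x measure topology" where
  "weak_star_topology M =
     topology_generated_by
       {{\<mu>\<in>M. (\<integral>x. f x \<partial>\<mu>) \<in> V} | f V. continuous_on UNIV (f :: 'x \<Rightarrow> real) \<and> open V}"

definition upper_semicontinuous_map :: "'a topology \<Rightarrow> ('a \<Rightarrow> real) \<Rightarrow> bool" where
  "upper_semicontinuous_map T f \<longleftrightarrow> (\<forall>a. openin T {x \<in> topspace T. f x < a})"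

definition borel_cover :: "'x::topological_space set set \<Rightarrow> bool" where
  "borel_cover \<U> \<longleftrightarrow> finite \<U> \<and> \<U> \<subseteq> sets borel \<and> \<Union>\<U> = UNIV"

(* Unlike for the library's partition_on, the empty set may be an element of a partition. *)
definition borel_partition :: "'x::topological_space set set \<Rightarrow> bool" where
  "borel_partition \<alpha> \<longleftrightarrow> borel_cover \<alpha> \<and> disjoint \<alpha>"

definition finer :: "'x set set \<Rightarrow> 'x set set \<Rightarrow> bool" where
  "finer \<U> \<V> \<longleftrightarrow> (\<forall>U\<in>\<U>. \<exists>V\<in>\<V>. U \<subseteq> V)"

(* \<U>_F, the join over g in F of the covers g^{-1}\<U>: its elements are the intersections obtained by
   choosing one element of g^{-1}\<U> for each g in F. *)
definition dyn_join :: "('g \<Rightarrow> 'x \<Rightarrow> 'x) \<Rightarrow> 'g set \<Rightarrow> 'x set set \<Rightarrow> 'x set set" where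
  "dyn_join \<phi> F \<U> = {(\<Inter>g\<in>F. \<phi> g -` c g) | c. \<forall>g\<in>F. c g \<in> \<U>}"

(* The convention 0 log 0 = 0 is built in, because the factor measure \<mu> A vanishes. *)
definition entropy_partition :: "'x measure \<Rightarrow> 'x set set \<Rightarrow> real" where
  "entropy_partition \<mu> \<alpha> = (\<Sum>A\<in>\<alpha>. - measure \<mu> A * ln (measure \<mu> A))"

(* The common limit along all Folner sequences.  For an amenable group, a G-system, an invariant
   measure \<mu> and a Borel partition \<alpha> it exists, by the Ornstein-Weiss lemma. *)
definition mean_entropy_partition ::
    "('g, 'm) monoid_scheme \<Rightarrow> ('g \<Rightarrow> 'x \<Rightarrow> 'x) \<Rightarrow> 'x measure \<Rightarrow> 'x set set \<Rightarrow> real" where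
  "mean_entropy_partition G \<phi> \<mu> \<alpha> =
     (THE h. \<forall>F. folner_sequence G F \<longrightarrow>
        (\<lambda>n. 1 / real (card (F n)) * entropy_partition \<mu> (dyn_join \<phi> (F n) \<alpha>)) \<longlonglongrightarrow> h)"

definition mean_entropy_cover ::
    "('g, 'm) monoid_scheme \<Rightarrow> ('g \<Rightarrow> 'x::topological_space \<Rightarrow> 'x) \<Rightarrow> 'x measure \<Rightarrow> 'x set set \<Rightarrow> real" where
  "mean_entropy_cover G \<phi> \<mu> \<U> =
     Inf {mean_entropy_partition G \<phi> \<mu> \<alpha> | \<alpha>. borel_partition \<alpha> \<and> finer \<alpha> \<U>}"

end

theory Submission
  imports Defs "HOL-Real_Asymp.Real_Asymp"
begin

text \<open>Write $H_\<mu>(F)$ for the entropy of the partition $\<alpha>_F$.  For an invariant measure the number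
  $h_\<mu>(G,\<alpha>)$ is not only the limit of $H_\<mu>(F_n)/|F_n|$ but also the infimum of
  $H_\<mu>(K)/|K|$ over all non-empty finite sets $K$.  Hence $h_\<mu>(G,\<alpha>) < a$ is witnessed by a
  single finite set $K$, and upper semicontinuity becomes a statement about finitely many atoms of
  one finite join.

  The infimum formula rests on the strong subadditivity of entropy, that is, on the fact that the gain
  $H(F \<union> \{x\}) - H(F)$ decreases when $F$ grows.  It yields a Shearer-type inequality: if
  every point of $F$ lies in exactly $k$ sets of a finite family, then $k H(F)$ is at most the sum of
  the entropies of the traces of these sets on $F$.  The translates $Kg$ with $g \<in> K^{-1}F$ cover every
  point of $F$ exactly $|K|$ times and all have entropy $H(K)$ because $\<mu>$ is invariant, so
  $|K| H(F) \<le> |K^{-1}F| H(K)$.  The Folner property gives $|K^{-1}F_n| \<le> (1+\<delta>)|F_n|$ for large $n$.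

  For the semicontinuity let $\<alpha>$ refine the open cover and let $H_\<mu>(\<alpha>_K)/|K| < a$.  Inner
  regularity gives closed subsets of the elements of $\<alpha>$ that carry almost all of their mass;
  these are separated by disjoint open sets $V_A$, each inside an element of the cover.
  The partition $\<beta>$ with elements $V_A \<union> (A \<setminus> \<Union> V)$ still refines the cover.  Each atom of
  $\<beta>_K$ contains an open set, the corresponding atom built from the $V_A$, whose $\<mu>$-measure is almost that
  of the corresponding atom of $\<alpha>_K$.  Measures of open sets are lower semicontinuous in the
  weak* topology, so for $\<nu>$ near $\<mu>$ no atom of $\<beta>_K$ has much less mass than the corresponding atom of
  $\<alpha>_K$ had under $\<mu>$.  Since both families of masses add up to $1$, no atom can have much
  more mass either, and so $H_\<nu>(\<beta>_K)/|K|$, an upper bound for $h_\<nu>(G,\<U>)$, is still below $a$.\<close>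

section \<open>The function -p ln p\<close>

definition entropy_term :: "real \<Rightarrow> real" where
  "entropy_term p = - p * ln p"

lemma entropy_term_0 [simp]: "entropy_term 0 = 0"
  and entropy_term_1 [simp]: "entropy_term 1 = 0"
  by (simp_all add: entropy_term_def)

lemma entropy_term_nonneg: "0 \<le> p \<Longrightarrow> p \<le> 1 \<Longrightarrow> 0 \<le> entropy_term p"
  by (cases "p = 0") (auto simp: entropy_term_def mult_nonneg_nonpos)

lemma continuous_on_entropy_term: "continuous_on {0..} entropy_term"
proof -
  have "(entropy_term \<longlongrightarrow> entropy_term x) (at x within {0..})" if "x \<ge> 0" for x
  proof (cases "x = 0")
    case True
    have "((\<lambda>p::real. - p * ln p) \<longlongrightarrow> 0) (at_right 0)"
      by real_asymp
    moreover have "(at 0 within {0::real..}) = at_right 0"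
      by (rule at_within_nhd[of _ UNIV]) auto
    ultimately show ?thesis
      using True by (simp add: entropy_term_def[abs_def])
  next
    case False
    then show ?thesis
      using that unfolding entropy_term_def by (intro tendsto_intros) auto
  qed
  then show ?thesis
    by (auto simp: continuous_on_def)
qed

text \<open>Splitting a mass $r$ into parts $p_a \<le> r$ can only increase $-p \ln p$ in total, as
  $-\ln p_a \<ge> -\ln r$.  This is the monotonicity of entropy under refinement.\<close>

lemma entropy_term_sum_le:
  assumes "finite I" and nn: "\<And>a. a \<in> I \<Longrightarrow> 0 \<le> p a"
  shows "entropy_term (\<Sum>a\<in>I. p a) \<le> (\<Sum>a\<in>I. entropy_term (p a))"
proof -
  have "p a * ln (p a) \<le> p a * ln (\<Sum>a\<in>I. p a)" if "a \<in> I" for a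
  proof (cases "p a = 0")
    case False
    then have "0 < p a"
      using nn[OF that] by simp
    moreover have "p a \<le> (\<Sum>a\<in>I. p a)"
      using assms that by (intro member_le_sum) auto
    ultimately show ?thesis
      by simp
  qed simp
  then have "(\<Sum>a\<in>I. p a * ln (p a)) \<le> (\<Sum>a\<in>I. p a * ln (\<Sum>a\<in>I. p a))"
    by (rule sum_mono)
  then show ?thesis
    by (simp add: entropy_term_def sum_negf sum_distrib_right)
qed

text \<open>Nonnegativity of mutual information for a finite measure of arbitrary total mass $r$.  The lack of
  a normalisation is what allows conditioning: the inequality is summed over the atoms of a third
  partition.  With marginals $x_a$ and $y_b$, the bound $\ln t \<le> t - 1$ for
  $t = x_a y_b / (p_{ab} r)$ reduces the claim to
  $\sum_{ab} (p_{ab} - x_a y_b / r) = 0$.\<close>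

lemma entropy_term_subadditive:
  fixes p :: "'a \<Rightarrow> 'b \<Rightarrow> real"
  assumes fin: "finite I" "finite J"
    and nn: "\<And>a b. a \<in> I \<Longrightarrow> b \<in> J \<Longrightarrow> 0 \<le> p a b"
  shows "entropy_term (\<Sum>a\<in>I. \<Sum>b\<in>J. p a b) + (\<Sum>a\<in>I. \<Sum>b\<in>J. entropy_term (p a b))
    \<le> (\<Sum>a\<in>I. entropy_term (\<Sum>b\<in>J. p a b)) + (\<Sum>b\<in>J. entropy_term (\<Sum>a\<in>I. p a b))"
proof -
  define x where "x a = (\<Sum>b\<in>J. p a b)" for a
  define y where "y b = (\<Sum>a\<in>I. p a b)" for b
  define r where "r = (\<Sum>a\<in>I. x a)"
  have r_y: "r = (\<Sum>b\<in>J. y b)"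
    unfolding r_def x_def y_def by (rule sum.swap)
  have x_nn: "0 \<le> x a" if "a \<in> I" for a
    using nn that by (auto simp: x_def intro: sum_nonneg)
  have y_nn: "0 \<le> y b" if "b \<in> J" for b
    using nn that by (auto simp: y_def intro: sum_nonneg)
  have r_nn: "0 \<le> r"
    unfolding r_def using x_nn by (rule sum_nonneg)
  have pointwise: "p a b - x a * y b / r
      \<le> p a b * ln (p a b) + p a b * ln r - p a b * ln (x a) - p a b * ln (y b)"
    if ab: "a \<in> I" "b \<in> J" for a b
  proof (cases "p a b = 0")
    case True
    then show ?thesis
      using x_nn[OF ab(1)] y_nn[OF ab(2)] r_nn by simp
  next
    case False
    then have p: "0 < p a b"
      using nn[OF ab] by simp
    have "p a b \<le> x a"
      unfolding x_def using fin nn ab by (intro member_le_sum) auto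
    moreover have "p a b \<le> y b"
      unfolding y_def using fin nn ab by (intro member_le_sum) auto
    moreover have "x a \<le> r"
      unfolding r_def using fin x_nn ab by (intro member_le_sum) auto
    ultimately have pos: "0 < x a" "0 < y b" "0 < r"
      using p by auto
    have "ln (x a * y b / (p a b * r)) \<le> x a * y b / (p a b * r) - 1"
      using pos p by (intro ln_le_minus_one) auto
    then have "p a b * ln (x a * y b / (p a b * r)) \<le> p a b * (x a * y b / (p a b * r) - 1)"
      using p by (intro mult_left_mono) auto
    moreover have "p a b * (x a * y b / (p a b * r) - 1) = x a * y b / r - p a b"
      using p by (simp add: field_simps)
    moreover have "ln (x a * y b / (p a b * r)) = ln (x a) + ln (y b) - ln (p a b) - ln r"
      using pos p by (simp add: ln_div ln_mult)
    ultimately have "p a b * (ln (x a) + ln (y b) - ln (p a b) - ln r) \<le> x a * y b / r - p a b"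
      by metis
    then show ?thesis
      by (simp add: algebra_simps)
  qed
  have "(\<Sum>a\<in>I. \<Sum>b\<in>J. x a * y b / r) = (\<Sum>a\<in>I. x a) * (\<Sum>b\<in>J. y b) / r"
    by (simp add: sum_product sum_divide_distrib)
  also have "\<dots> = r"
    by (cases "r = 0") (simp_all flip: r_def r_y)
  finally have "0 = (\<Sum>a\<in>I. \<Sum>b\<in>J. p a b - x a * y b / r)"
    by (simp add: sum_subtractf r_def x_def)
  also have "\<dots> \<le> (\<Sum>a\<in>I. \<Sum>b\<in>J.
      p a b * ln (p a b) + p a b * ln r - p a b * ln (x a) - p a b * ln (y b))"
    by (intro sum_mono pointwise)
  also have "\<dots> = (\<Sum>a\<in>I. \<Sum>b\<in>J. p a b * ln (p a b)) + r * ln r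
      - (\<Sum>a\<in>I. x a * ln (x a)) - (\<Sum>a\<in>I. \<Sum>b\<in>J. p a b * ln (y b))"
    by (simp add: sum.distrib sum_subtractf r_def x_def flip: sum_distrib_right)
  also have "(\<Sum>a\<in>I. \<Sum>b\<in>J. p a b * ln (y b)) = (\<Sum>b\<in>J. y b * ln (y b))"
    by (subst sum.swap) (simp add: y_def sum_distrib_right)
  finally show ?thesis
    by (simp add: entropy_term_def sum_negf flip: x_def y_def r_def)
qed

lemma entropy_term_sum_near:
  fixes p :: "'c \<Rightarrow> real"
  assumes N: "finite N" and p: "\<And>c. c \<in> N \<Longrightarrow> 0 \<le> p c" and e: "0 < e"
  shows "\<exists>\<delta>>0. \<forall>q. (\<forall>c\<in>N. 0 \<le> q c \<and> \<bar>q c - p c\<bar> < \<delta>) \<longrightarrow>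
    (\<Sum>c\<in>N. entropy_term (q c)) < (\<Sum>c\<in>N. entropy_term (p c)) + e"
  using assms
proof (induction N arbitrary: e)
  case empty
  then show ?case
    by (intro exI[of _ 1]) simp
next
  case (insert c N)
  have "\<exists>d>0. \<forall>x\<in>{0..}. dist x (p c) < d \<longrightarrow> dist (entropy_term x) (entropy_term (p c)) < e / 2"
  proof -
    have "p c \<in> {0..}" "0 < e / 2"
      using insert.prems by simp_all
    then show ?thesis
      using continuous_on_entropy_term unfolding continuous_on_iff by blast
  qed
  then obtain d where d: "0 < d"
    "\<And>x. 0 \<le> x \<Longrightarrow> \<bar>x - p c\<bar> < d \<Longrightarrow> \<bar>entropy_term x - entropy_term (p c)\<bar> < e / 2"
    by (auto simp: dist_real_def)
  from insert.IH[of "e / 2"] insert.prems obtain \<delta> where \<delta>: "0 < \<delta>"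
    "\<forall>q. (\<forall>c\<in>N. 0 \<le> q c \<and> \<bar>q c - p c\<bar> < \<delta>) \<longrightarrow>
      (\<Sum>c\<in>N. entropy_term (q c)) < (\<Sum>c\<in>N. entropy_term (p c)) + e / 2"
    by auto
  have "(\<Sum>c\<in>insert c N. entropy_term (q c)) < (\<Sum>c\<in>insert c N. entropy_term (p c)) + e"
    if q: "\<forall>a\<in>insert c N. 0 \<le> q a \<and> \<bar>q a - p a\<bar> < min d \<delta>" for q
  proof -
    have "(\<Sum>c\<in>N. entropy_term (q c)) < (\<Sum>c\<in>N. entropy_term (p c)) + e / 2"
      using \<delta>(2) q by simp
    moreover have "\<bar>entropy_term (q c) - entropy_term (p c)\<bar> < e / 2"
      using q by (intro d(2)) auto
    ultimately show ?thesis
      unfolding sum.insert[OF insert.hyps] by linarith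
  qed
  then show ?case
    using d(1) \<delta>(1) by (intro exI[of _ "min d \<delta>"] conjI allI impI) auto
qed

text \<open>A lower bound for every entry is also an upper bound for every entry once the totals agree: an
  excess at $c$ has to be made up for by the deficits of the other entries.\<close>

lemma equal_sum_lower_bounds_imp_close:
  fixes p q :: "'c \<Rightarrow> real"
  assumes N: "finite N" "c \<in> N" and sums: "sum q N = sum p N" and d: "0 < d"
    and lower: "\<And>a. a \<in> N \<Longrightarrow> p a - d < q a"
  shows "\<bar>q c - p c\<bar> < real (card N) * d"
proof -
  have card: "real (card N) = real (card (N - {c})) + 1"
    using N by (simp add: card_Suc_Diff1[symmetric, of N c] del: card_Diff_insert)
  have "(\<Sum>a\<in>N - {c}. p a - q a) \<le> (\<Sum>a\<in>N - {c}. d)"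
    using lower by (intro sum_mono) (auto simp: less_imp_le algebra_simps)
  moreover have "q c - p c = (\<Sum>a\<in>N - {c}. p a - q a)"
    using sums N sum.remove[of N c p] sum.remove[of N c q] by (simp add: sum_subtractf)
  ultimately have "q c - p c < real (card N) * d"
    using d by (simp add: card algebra_simps)
  moreover have "- d < q c - p c"
    using lower[OF N(2)] by simp
  moreover have "d \<le> real (card N) * d"
    using d by (simp add: card algebra_simps)
  ultimately show ?thesis
    by (simp add: abs_less_iff)
qed

section \<open>Entropy of joins of finite partitions\<close>

text \<open>The partition attached to $g$ is indexed by labels, and some $P_g(a)$ may be empty.  An atom of a join is then
  a labelling $c$, which makes the recursion over the index set a matter of reindexing sums.\<close>

locale finite_partition_family = prob_space M
  for M :: "'x measure" +
  fixes I :: "'i set" and P :: "'g \<Rightarrow> 'i \<Rightarrow> 'x set" and E :: "'g set"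
  assumes space_UNIV: "space M = UNIV"
    and finite_I: "finite I"
    and P_sets: "\<And>g a. g \<in> E \<Longrightarrow> a \<in> I \<Longrightarrow> P g a \<in> sets M"
    and P_disjoint: "\<And>g. g \<in> E \<Longrightarrow> disjoint_family_on (P g) I"
    and P_cover: "\<And>g. g \<in> E \<Longrightarrow> (\<Union>a\<in>I. P g a) = UNIV"

definition joint_entropy :: "'x measure \<Rightarrow> 'i set \<Rightarrow> ('g \<Rightarrow> 'i \<Rightarrow> 'x set) \<Rightarrow> 'g set \<Rightarrow> real" where
  "joint_entropy M I P S = (\<Sum>c\<in>PiE S (\<lambda>_. I). entropy_term (measure M (\<Inter>g\<in>S. P g (c g))))"

lemma sum_PiE_insert:
  assumes "x \<notin> S"
  shows "(\<Sum>c\<in>PiE (insert x S) (\<lambda>_. I). f c) = (\<Sum>c\<in>PiE S (\<lambda>_. I). \<Sum>a\<in>I. f (c(x := a)))"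
proof -
  have "(\<Sum>c\<in>PiE (insert x S) (\<lambda>_. I). f c)
      = (\<Sum>(a, c)\<in>I \<times> PiE S (\<lambda>_. I). f (c(x := a)))"
    unfolding PiE_insert_eq using inj_combinator[OF assms, of "\<lambda>_. I"]
    by (subst sum.reindex) (auto simp: case_prod_unfold)
  also have "\<dots> = (\<Sum>a\<in>I. \<Sum>c\<in>PiE S (\<lambda>_. I). f (c(x := a)))"
    by (rule sum.cartesian_product[symmetric])
  finally show ?thesis
    by (simp add: sum.swap[of _ I])
qed

lemma INT_insert_fun_upd:
  assumes "x \<notin> S"
  shows "(\<Inter>g\<in>insert x S. P g ((c(x := a)) g)) = P x a \<inter> (\<Inter>g\<in>S. P g (c g))"
proof -
  have "(\<Inter>g\<in>S. P g ((c(x := a)) g)) = (\<Inter>g\<in>S. P g (c g))"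
    using assms by (intro INF_cong) auto
  then show ?thesis
    by simp
qed

lemma joint_entropy_insert:
  assumes "x \<notin> S"
  shows "joint_entropy M I P (insert x S)
    = (\<Sum>c\<in>PiE S (\<lambda>_. I). \<Sum>a\<in>I. entropy_term (measure M (P x a \<inter> (\<Inter>g\<in>S. P g (c g)))))"
  unfolding joint_entropy_def sum_PiE_insert[OF assms] INT_insert_fun_upd[OF assms] ..

lemma joint_entropy_reindex:
  assumes "inj_on h S"
  shows "joint_entropy M I P (h ` S) = joint_entropy M I (\<lambda>s. P (h s)) S"
  unfolding joint_entropy_def
proof (rule sum.reindex_bij_witness)
  let ?i = "\<lambda>d. \<lambda>t\<in>h ` S. d (the_inv_into S h t)"
  let ?j = "\<lambda>c. \<lambda>s\<in>S. c (h s)"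
  show "?i (?j c) = c" if "c \<in> PiE (h ` S) (\<lambda>_. I)" for c
    using that assms by (auto simp: fun_eq_iff PiE_def extensional_def the_inv_into_f_f)
  show "?j (?i d) = d" if "d \<in> PiE S (\<lambda>_. I)" for d
    using that assms by (auto simp: fun_eq_iff PiE_def extensional_def the_inv_into_f_f)
  show "?j c \<in> PiE S (\<lambda>_. I)" if "c \<in> PiE (h ` S) (\<lambda>_. I)" for c
    using that by auto
  show "?i d \<in> PiE (h ` S) (\<lambda>_. I)" if "d \<in> PiE S (\<lambda>_. I)" for d
    using that assms by (auto simp: the_inv_into_f_f)
  show "entropy_term (measure M (\<Inter>s\<in>S. P (h s) (?j c s)))
      = entropy_term (measure M (\<Inter>g\<in>h ` S. P g (c g)))" for c
    by (auto intro!: arg_cong[where f = "measure M"] arg_cong[where f = entropy_term])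
qed

context finite_partition_family
begin

lemma sets_atom:
  assumes "finite S" "S \<subseteq> E" "c \<in> PiE S (\<lambda>_. I)"
  shows "(\<Inter>g\<in>S. P g (c g)) \<in> sets M"
proof (cases "S = {}")
  case True
  then show ?thesis
    using space_UNIV sets.top[of M] by simp
next
  case False
  then show ?thesis
    using assms P_sets by (intro sets.finite_INT) (auto simp: PiE_def Pi_def subset_iff)
qed

lemma measure_split:
  assumes "x \<in> E" "A \<in> sets M"
  shows "(\<Sum>a\<in>I. measure M (P x a \<inter> A)) = measure M A"
proof -
  have "measure M A = measure M (\<Union>a\<in>I. P x a \<inter> A)"
    using P_cover[OF assms(1)] by (intro arg_cong[where f = "measure M"]) auto
  also have "\<dots> = (\<Sum>a\<in>I. measure M (P x a \<inter> A))"
    using assms P_sets[OF assms(1)] P_disjoint[OF assms(1)] finite_I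
    by (intro finite_measure_finite_Union) (auto simp: disjoint_family_on_def)
  finally show ?thesis ..
qed

lemma sum_measure_atoms:
  assumes "finite S" "S \<subseteq> E"
  shows "(\<Sum>c\<in>PiE S (\<lambda>_. I). measure M (\<Inter>g\<in>S. P g (c g))) = 1"
  using assms
proof (induction S)
  case empty
  then show ?case
    using prob_space space_UNIV by simp
next
  case (insert x S)
  show ?case
    unfolding sum_PiE_insert[OF insert.hyps(2)] INT_insert_fun_upd[OF insert.hyps(2)]
    using insert by (simp add: measure_split sets_atom)
qed

lemma joint_entropy_nonneg: "0 \<le> joint_entropy M I P S"
  unfolding joint_entropy_def by (intro sum_nonneg entropy_term_nonneg) auto

lemma joint_entropy_empty: "joint_entropy M I P {} = 0"
  using prob_space space_UNIV by (simp add: joint_entropy_def)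

lemma joint_entropy_le_insert:
  assumes "finite S" "S \<subseteq> E" "x \<in> E"
  shows "joint_entropy M I P S \<le> joint_entropy M I P (insert x S)"
proof (cases "x \<in> S")
  case False
  have "entropy_term (measure M (\<Inter>g\<in>S. P g (c g)))
      \<le> (\<Sum>a\<in>I. entropy_term (measure M (P x a \<inter> (\<Inter>g\<in>S. P g (c g)))))"
    if "c \<in> PiE S (\<lambda>_. I)" for c
    using entropy_term_sum_le[OF finite_I, of "\<lambda>a. measure M (P x a \<inter> (\<Inter>g\<in>S. P g (c g)))"]
      measure_split[OF \<open>x \<in> E\<close> sets_atom[OF assms(1,2) that]] by simp
  then show ?thesis
    by (subst joint_entropy_insert[OF False], subst joint_entropy_def) (rule sum_mono)
qed (simp add: insert_absorb)

lemma joint_entropy_mono: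
  assumes "S \<subseteq> T" "finite T" "T \<subseteq> E"
  shows "joint_entropy M I P S \<le> joint_entropy M I P T"
proof -
  have "joint_entropy M I P S \<le> joint_entropy M I P (S \<union> R)"
    if "finite R" "R \<subseteq> T" for R
    using that
  proof (induction R)
    case (insert x R)
    have "joint_entropy M I P (S \<union> R) \<le> joint_entropy M I P (insert x (S \<union> R))"
      using insert.prems insert.hyps assms finite_subset[of S T]
      by (intro joint_entropy_le_insert) auto
    then show ?case
      using insert by simp
  qed simp
  from this[of T] show ?thesis
    using assms by (simp add: Un_absorb1)
qed

text \<open>On each atom of the join over $S$ the masses of the pairs of labels at $x$ and $y$ form a matrix
  whose marginals belong to the joins over $S \<union> \{x\}$ and $S \<union> \{y\}$; the subadditivity of
  $-p \ln p$ is applied atom by atom.\<close>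

lemma joint_entropy_submodular_local:
  assumes S: "finite S" "S \<subseteq> E" and xy: "x \<in> E" "y \<in> E" "x \<notin> S" "y \<notin> S" "x \<noteq> y"
  shows "joint_entropy M I P S + joint_entropy M I P (insert x (insert y S))
    \<le> joint_entropy M I P (insert x S) + joint_entropy M I P (insert y S)"
proof -
  let ?A = "\<lambda>c. \<Inter>g\<in>S. P g (c g)"
  let ?p = "\<lambda>c a b. measure M (P x a \<inter> P y b \<inter> ?A c)"
  have split_y: "(\<Sum>b\<in>I. ?p c a b) = measure M (P x a \<inter> ?A c)"
    if "c \<in> PiE S (\<lambda>_. I)" "a \<in> I" for c a
    using measure_split[OF xy(2), of "P x a \<inter> ?A c"] sets_atom[OF S that(1)] P_sets[OF xy(1) that(2)]
    by (simp add: Int_ac)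
  have split_x: "(\<Sum>a\<in>I. ?p c a b) = measure M (P y b \<inter> ?A c)"
    if "c \<in> PiE S (\<lambda>_. I)" "b \<in> I" for c b
    using measure_split[OF xy(1), of "P y b \<inter> ?A c"] sets_atom[OF S that(1)] P_sets[OF xy(2) that(2)]
    by (simp add: Int_ac)
  have whole: "(\<Sum>a\<in>I. \<Sum>b\<in>I. ?p c a b) = measure M (?A c)" if "c \<in> PiE S (\<lambda>_. I)" for c
    using measure_split[OF xy(1) sets_atom[OF S that]] by (simp add: split_y[OF that])
  have "joint_entropy M I P (insert x (insert y S))
      = (\<Sum>c\<in>PiE S (\<lambda>_. I). \<Sum>a\<in>I. \<Sum>b\<in>I. entropy_term (?p c a b))"
  proof -
    have "x \<notin> insert y S"
      using xy by auto
    then show ?thesis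
      unfolding joint_entropy_insert[OF \<open>x \<notin> insert y S\<close>] sum_PiE_insert[OF xy(4)]
        INT_insert_fun_upd[OF xy(4)] Int_assoc
      by (intro sum.cong refl sum.swap)
  qed
  moreover have "entropy_term (measure M (?A c)) + (\<Sum>a\<in>I. \<Sum>b\<in>I. entropy_term (?p c a b))
      \<le> (\<Sum>a\<in>I. entropy_term (measure M (P x a \<inter> ?A c)))
        + (\<Sum>b\<in>I. entropy_term (measure M (P y b \<inter> ?A c)))" if "c \<in> PiE S (\<lambda>_. I)" for c
    using entropy_term_subadditive[OF finite_I finite_I, of "?p c"]
    unfolding whole[OF that] by (simp add: split_x[OF that] split_y[OF that] cong: sum.cong)
  ultimately show ?thesis
    using xy unfolding joint_entropy_insert[OF xy(3)] joint_entropy_insert[OF xy(4)]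
    by (simp add: joint_entropy_def sum_mono flip: sum.distrib)
qed

text \<open>Strong subadditivity in the form of decreasing gains: the local inequality is iterated while $S$
  grows to $T$ one element at a time.\<close>

lemma joint_entropy_increment_antimono:
  assumes "S \<subseteq> T" "finite T" "T \<subseteq> E" "x \<in> E" "x \<notin> T"
  shows "joint_entropy M I P (insert x T) - joint_entropy M I P T
    \<le> joint_entropy M I P (insert x S) - joint_entropy M I P S"
proof -
  have "joint_entropy M I P (insert x (S \<union> R)) - joint_entropy M I P (S \<union> R)
    \<le> joint_entropy M I P (insert x S) - joint_entropy M I P S"
    if "finite R" "R \<subseteq> T - S" for R
    using that
  proof (induction R)
    case (insert y R)
    have "joint_entropy M I P (S \<union> R) + joint_entropy M I P (insert x (insert y (S \<union> R)))
      \<le> joint_entropy M I P (insert x (S \<union> R)) + joint_entropy M I P (insert y (S \<union> R))"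
      using insert.prems insert.hyps assms finite_subset[of S T]
      by (intro joint_entropy_submodular_local) auto
    then show ?case
      using insert by simp
  qed simp
  from this[of "T - S"] show ?thesis
    using assms by (simp add: Un_absorb1)
qed

end

context finite_partition_family
begin

text \<open>Adding $x$ to $F$ raises the left side by $k$ times the gain of $x$ over $F$.  On the
  right exactly the $k$ traces of sets containing $x$ change, and each of them rises by the gain of
  $x$ over a smaller set, which is at least as large.\<close>

lemma shearer_inequality:
  assumes "finite J" "finite F" "F \<subseteq> E"
    and cover: "\<And>f. f \<in> F \<Longrightarrow> card {j \<in> J. f \<in> K j} = k"
  shows "real k * joint_entropy M I P F \<le> (\<Sum>j\<in>J. joint_entropy M I P (K j \<inter> F))"
  using assms(2-)
proof (induction F)
  case empty
  then show ?case
    by (simp add: joint_entropy_empty)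
next
  case (insert x F)
  let ?H = "joint_entropy M I P"
  let ?J = "{j \<in> J. x \<in> K j}"
  have increment: "?H (insert x F) - ?H F \<le> ?H (K j \<inter> insert x F) - ?H (K j \<inter> F)"
    if "j \<in> ?J" for j
    using joint_entropy_increment_antimono[of "K j \<inter> F" F x] insert that by simp
  have same: "K j \<inter> insert x F = K j \<inter> F" if "j \<in> J - ?J" for j
    using that by auto
  have "real k * (?H (insert x F) - ?H F) = (\<Sum>j\<in>?J. ?H (insert x F) - ?H F)"
    using insert.prems(2)[of x] by simp
  also have "\<dots> \<le> (\<Sum>j\<in>?J. ?H (K j \<inter> insert x F) - ?H (K j \<inter> F))"
    by (intro sum_mono increment)
  also have "\<dots> = (\<Sum>j\<in>J. ?H (K j \<inter> insert x F) - ?H (K j \<inter> F))"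
    using assms(1) same by (intro sum.mono_neutral_left) auto
  finally have "real k * ?H (insert x F) - real k * ?H F
      \<le> (\<Sum>j\<in>J. ?H (K j \<inter> insert x F)) - (\<Sum>j\<in>J. ?H (K j \<inter> F))"
    by (simp add: sum_subtractf right_diff_distrib)
  moreover have "real k * ?H F \<le> (\<Sum>j\<in>J. ?H (K j \<inter> F))"
    using insert by simp
  ultimately show ?case
    by linarith
qed

end

section \<open>Measures on metric spaces\<close>

text \<open>The neighbourhoods of radius $1/(n+1)$ decrease to the closed set.\<close>

lemma closed_imp_open_approx:
  fixes M :: "'x::metric_space measure"
  assumes "finite_measure M" and M: "sets M = sets borel" and A: "closed A" and e: "0 < e"
  obtains U where "open U" "A \<subseteq> U" "measure M (U - A) < e"
proof (cases "A = {}")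
  case True
  then show ?thesis
    using that[of "{}"] e by simp
next
  case False
  interpret finite_measure M
    by fact
  define U where "U n = {x. infdist x A < 1 / real (Suc n)}" for n
  have openU: "open (U n)" for n
    unfolding U_def by (intro open_Collect_less continuous_intros)
  have "decseq U"
  proof (rule decseq_SucI, rule subsetI)
    fix n x assume "x \<in> U (Suc n)"
    moreover have "1 / real (Suc (Suc n)) \<le> 1 / real (Suc n)"
      by (intro divide_left_mono) auto
    ultimately show "x \<in> U n"
      unfolding U_def by simp
  qed
  moreover have sets: "range U \<subseteq> sets M"
    using openU M by auto
  ultimately have "(\<lambda>n. measure M (U n)) \<longlonglongrightarrow> measure M (\<Inter>n. U n)"
    by (intro finite_Lim_measure_decseq)
  moreover have "(\<Inter>n. U n) = A"
  proof (intro equalityI subsetI)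
    fix x assume "x \<in> (\<Inter>n. U n)"
    then have less: "infdist x A < 1 / real (Suc n)" for n
      by (auto simp: U_def)
    have "infdist x A \<le> 0"
    proof (rule ccontr)
      assume "\<not> infdist x A \<le> 0"
      then obtain n where "1 / real (Suc n) < infdist x A"
        using nat_approx_posE[of "infdist x A"] by (metis not_le)
      then show False
        using less[of n] by linarith
    qed
    then show "x \<in> A"
      using in_closed_iff_infdist_zero[OF A False] infdist_nonneg[of x A] by auto
  next
    fix x assume "x \<in> A"
    then show "x \<in> (\<Inter>n. U n)"
      by (simp add: U_def)
  qed
  ultimately have "(\<lambda>n. measure M (U n)) \<longlonglongrightarrow> measure M A"
    by simp
  then have "\<forall>\<^sub>F n in sequentially. measure M (U n) < measure M A + e"
    using e by (intro order_tendstoD(2)) auto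
  then obtain n where n: "measure M (U n) < measure M A + e"
    unfolding eventually_sequentially by blast
  have AU: "A \<subseteq> U n"
    by (auto simp: U_def)
  show ?thesis
  proof (rule that[OF openU AU])
    show "measure M (U n - A) < e"
      using n A AU sets M by (subst finite_measure_Diff) auto
  qed
qed

text \<open>Regularity with closed instead of compact sets, which holds in every metric space.  The two-sided
  statement is what passes to complements.  In a countable union the inner
  sets are only unioned up to a finite stage to remain closed; half of $e$ is spent on this
  truncation and half on the sum of the individual errors.\<close>

lemma borel_closed_open_approx:
  fixes M :: "'x::metric_space measure"
  assumes fin: "finite_measure M" and M: "sets M = sets borel" and A: "A \<in> sets borel"
  shows "0 < e \<Longrightarrow> \<exists>C U. closed C \<and> open U \<and> C \<subseteq> A \<and> A \<subseteq> U \<and> measure M (U - C) < e"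
proof -
  interpret finite_measure M
    by (rule fin)
  have "A \<in> sigma_sets UNIV (Collect closed)"
    using A by (simp add: borel_eq_closed)
  then show "0 < e \<Longrightarrow> \<exists>C U. closed C \<and> open U \<and> C \<subseteq> A \<and> A \<subseteq> U \<and> measure M (U - C) < e"
  proof (induction arbitrary: e rule: sigma_sets.induct)
    case (Basic A)
    then have cl: "closed A"
      by simp
    obtain U where "open U" "A \<subseteq> U" "measure M (U - A) < e"
      by (rule closed_imp_open_approx[OF fin M cl Basic.prems])
    then show ?case
      using cl by (intro exI[of _ A] exI[of _ U]) simp
  next
    case Empty
    then show ?case
      by (intro exI[of _ "{}"]) simp
  next
    case (Compl A)
    obtain C U where CU: "closed C" "open U" "C \<subseteq> A" "A \<subseteq> U" "measure M (U - C) < e"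
      using Compl.IH[OF Compl.prems] by (elim exE conjE)
    have "- C - - U = U - C"
      by auto
    then have "closed (- U) \<and> open (- C) \<and> - U \<subseteq> UNIV - A \<and> UNIV - A \<subseteq> - C \<and> measure M (- C - - U) < e"
      using CU by (simp add: closed_Compl open_Compl) auto
    then show ?case
      by (intro exI[of _ "- U"] exI[of _ "- C"])
  next
    case (Union A)
    define r where "r i = e * (1 / 2) ^ Suc i / 2" for i
    have r_pos: "0 < r i" for i
      using Union.prems by (simp add: r_def)
    have r_sums: "r sums (e / 2)"
    proof -
      have "(\<lambda>i. (e / 2) * (1 / 2) ^ Suc i) sums (e / 2 * 1)"
        by (intro sums_mult power_half_series)
      then show ?thesis
        by (simp add: r_def[abs_def] field_simps)
    qed
    have "\<forall>i. \<exists>CU. closed (fst CU) \<and> open (snd CU) \<and> fst CU \<subseteq> A i \<and> A i \<subseteq> snd CU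
        \<and> measure M (snd CU - fst CU) < r i"
      using Union.IH[OF r_pos] by simp
    from choice[OF this] obtain f where f: "\<forall>i. closed (fst (f i)) \<and> open (snd (f i))
        \<and> fst (f i) \<subseteq> A i \<and> A i \<subseteq> snd (f i) \<and> measure M (snd (f i) - fst (f i)) < r i" ..
    define C where "C i = fst (f i)" for i
    define U where "U i = snd (f i)" for i
    have CU: "closed (C i)" "open (U i)" "C i \<subseteq> A i" "A i \<subseteq> U i" "measure M (U i - C i) < r i" for i
      using f by (simp_all add: C_def U_def)
    have CM: "C i \<in> sets M" and UM: "U i \<in> sets M" for i
      using CU(1,2)[of i] M by auto
    have "(\<lambda>n. measure M (\<Union>i\<le>n. C i)) \<longlonglongrightarrow> measure M (\<Union>n. \<Union>i\<le>n. C i)"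
    proof (rule finite_Lim_measure_incseq)
      show "range (\<lambda>n. \<Union>i\<le>n. C i) \<subseteq> sets M"
        using CM by auto
      show "incseq (\<lambda>n. \<Union>i\<le>n. C i)"
        by (intro monoI UN_mono) auto
    qed
    moreover have "(\<Union>n. \<Union>i\<le>n. C i) = (\<Union>i. C i)"
      by blast
    ultimately have "\<forall>\<^sub>F n in sequentially. measure M (\<Union>i. C i) - e / 2 < measure M (\<Union>i\<le>n. C i)"
      using Union.prems by (intro order_tendstoD(1)) auto
    then obtain n where n: "measure M (\<Union>i. C i) - e / 2 < measure M (\<Union>i\<le>n. C i)"
      unfolding eventually_sequentially by blast
    have "measure M (\<Union>i. U i - C i) \<le> (\<Sum>i. measure M (U i - C i))"
    proof (rule finite_measure_subadditive_countably)
      show "range (\<lambda>i. U i - C i) \<subseteq> sets M"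
        using CM UM by auto
      show "summable (\<lambda>i. measure M (U i - C i))"
        by (rule summable_comparison_test'[OF sums_summable[OF r_sums], of 0])
          (simp add: CU(5) less_imp_le)
    qed
    also have "\<dots> \<le> (\<Sum>i. r i)"
    proof (rule suminf_le)
      show "summable (\<lambda>i. measure M (U i - C i))"
        by (rule summable_comparison_test'[OF sums_summable[OF r_sums], of 0])
          (simp add: CU(5) less_imp_le)
    qed (use CU(5) r_sums sums_summable in \<open>auto intro: less_imp_le\<close>)
    also have "\<dots> = e / 2"
      using r_sums by (rule sums_unique[symmetric])
    finally have outer: "measure M (\<Union>i. U i - C i) \<le> e / 2" .
    have inner: "measure M ((\<Union>i. C i) - (\<Union>i\<le>n. C i)) < e / 2"
    proof -
      have "(\<Union>i\<le>n. C i) \<subseteq> (\<Union>i. C i)"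
        by blast
      then show ?thesis
        using n CM by (subst finite_measure_Diff) auto
    qed
    have "measure M ((\<Union>i. U i) - (\<Union>i\<le>n. C i))
        \<le> measure M ((\<Union>i. U i - C i) \<union> ((\<Union>i. C i) - (\<Union>i\<le>n. C i)))"
      using CM UM by (intro finite_measure_mono) auto
    also have "\<dots> \<le> measure M (\<Union>i. U i - C i) + measure M ((\<Union>i. C i) - (\<Union>i\<le>n. C i))"
      using CM UM by (intro measure_Un_le) auto
    finally have "measure M ((\<Union>i. U i) - (\<Union>i\<le>n. C i)) < e"
      using outer inner by linarith
    moreover have "closed (\<Union>i\<le>n. C i)" "open (\<Union>i. U i)"
      using CU(1,2) by (auto intro: closed_UN)
    moreover have "(\<Union>i\<le>n. C i) \<subseteq> (\<Union>i. A i)" "(\<Union>i. A i) \<subseteq> (\<Union>i. U i)"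
      using CU(3,4) by (fast, fast)
    ultimately show ?case
      by (intro exI[of _ "\<Union>i\<le>n. C i"] exI[of _ "\<Union>i. U i"] conjI)
  qed
qed

lemma borel_inner_closed:
  fixes M :: "'x::metric_space measure"
  assumes "finite_measure M" and M: "sets M = sets borel" and A: "A \<in> sets borel" and "0 < e"
  shows "\<exists>C. closed C \<and> C \<subseteq> A \<and> measure M (A - C) < e"
proof -
  interpret finite_measure M
    by fact
  from borel_closed_open_approx[OF assms]
  obtain C U where CU: "closed C" "open U" "C \<subseteq> A" "A \<subseteq> U" "measure M (U - C) < e"
    by (elim exE conjE)
  have "measure M (A - C) \<le> measure M (U - C)"
    using CU M by (intro finite_measure_mono) auto
  then show ?thesis
    using CU by (intro exI[of _ C]) simp
qed

lemma disjoint_closed_separation: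
  fixes C :: "'i \<Rightarrow> 'x::t4_space set"
  assumes "finite I" "\<And>i. i \<in> I \<Longrightarrow> closed (C i)" "disjoint_family_on C I"
  shows "\<exists>V. (\<forall>i\<in>I. open (V i) \<and> C i \<subseteq> V i) \<and> disjoint_family_on V I"
  using assms
proof (induction I)
  case empty
  then show ?case
    by (simp add: disjoint_family_on_def)
next
  case (insert j I)
  have "disjoint_family_on C I"
    using insert.prems(2) by (rule disjoint_family_on_mono[rotated]) auto
  then obtain V where V: "\<forall>i\<in>I. open (V i) \<and> C i \<subseteq> V i" "disjoint_family_on V I"
    using insert.IH insert.prems(1) by (metis insertCI)
  have "closed (\<Union>i\<in>I. C i)"
    using insert by (intro closed_UN) auto
  moreover have "C j \<inter> (\<Union>i\<in>I. C i) = {}"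
    using insert.hyps(2) insert.prems(2) by (fastforce simp: disjoint_family_on_def)
  ultimately obtain U W where UW: "open U" "open W" "C j \<subseteq> U" "(\<Union>i\<in>I. C i) \<subseteq> W" "U \<inter> W = {}"
    using t4_space[of "C j" "\<Union>i\<in>I. C i"] insert.prems(1) by (metis insertCI)
  define V' where "V' i = (if i = j then U else V i \<inter> W)" for i
  have "\<forall>i\<in>insert j I. open (V' i) \<and> C i \<subseteq> V' i"
    using V(1) UW insert.hyps(2) by (auto simp: V'_def)
  moreover have "disjoint_family_on V' (insert j I)"
    using V(2) UW(5) insert.hyps(2) by (fastforce simp: V'_def disjoint_family_on_def)
  ultimately show ?case
    by blast
qed

text \<open>Lower semicontinuity of the measure of an open set: at a given $\<mu>$ a continuous function between the
  indicators of a closed subset of almost full measure and of the open set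
  itself has integral above $a$, and this persists on a basic neighbourhood.\<close>

lemma openin_weak_star_measure_greater:
  fixes M :: "'x::metric_space measure set"
  assumes M: "\<And>\<mu>. \<mu> \<in> M \<Longrightarrow> prob_space \<mu> \<and> sets \<mu> = sets borel" and A: "open A"
  shows "openin (weak_star_topology M) {\<mu>\<in>M. a < measure \<mu> A}"
proof (subst openin_subopen, intro ballI)
  fix \<mu> assume "\<mu> \<in> {\<mu>\<in>M. a < measure \<mu> A}"
  then have \<mu>: "\<mu> \<in> M" "a < measure \<mu> A"
    by auto
  interpret prob_space \<mu>
    using M[OF \<mu>(1)] ..
  have s: "sets \<mu> = sets borel"
    using M[OF \<mu>(1)] ..
  have Ab: "A \<in> sets borel"
    using A by simp
  have "0 < measure \<mu> A - a"
    using \<mu>(2) by simp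
  from borel_inner_closed[OF finite_measure_axioms s Ab this]
  obtain C where C: "closed C" "C \<subseteq> A" "measure \<mu> (A - C) < measure \<mu> A - a"
    by (elim exE conjE)
  have "measure \<mu> (A - C) = measure \<mu> A - measure \<mu> C"
    using C Ab s by (intro finite_measure_Diff) auto
  then have aC: "a < measure \<mu> C"
    using C(3) by linarith
  have "normal_space (euclidean :: 'x topology)"
    by (simp add: metrizable_imp_normal_space metrizable_space_euclidean)
  then obtain f where f: "continuous_map euclidean (top_of_set {0..1::real}) f" "f ` (- A) \<subseteq> {0}" "f ` C \<subseteq> {1}"
    by (rule Urysohn_lemma[of euclidean "- A" C 0 1]) (use A C in \<open>auto simp: disjnt_def closed_Compl\<close>)
  have cont: "continuous_on UNIV f" and f01: "0 \<le> f x" "f x \<le> 1" for x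
    using f(1) by (auto simp: continuous_map_in_subtopology)
  have le: "f x \<le> indicator A x" and ge: "indicator C x \<le> f x" for x
    using f(2,3) f01[of x] by (auto simp: indicator_def image_subset_iff)
  have int_f: "integrable \<nu> f" if "\<nu> \<in> M" for \<nu>
  proof -
    interpret \<nu>: prob_space \<nu>
      using M[OF that] ..
    have "f \<in> borel_measurable \<nu>"
      using borel_measurable_continuous_onI[OF cont] M[OF that] measurable_cong_sets[of \<nu> borel borel borel]
      by blast
    then show ?thesis
      using f01 by (intro \<nu>.integrable_const_bound[of _ 1]) auto
  qed
  have upper: "(\<integral>x. f x \<partial>\<nu>) \<le> measure \<nu> A" if "\<nu> \<in> M" for \<nu>
  proof -
    interpret \<nu>: prob_space \<nu>
      using M[OF that] ..
    have "A \<in> sets \<nu>"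
      using M[OF that] Ab by simp
    then have "(\<integral>x. f x \<partial>\<nu>) \<le> (\<integral>x. indicator A x \<partial>\<nu>)"
      using int_f[OF that] le by (intro integral_mono) (auto simp: \<nu>.emeasure_eq_measure)
    then show ?thesis
      using \<open>A \<in> sets \<nu>\<close> by simp
  qed
  have "C \<in> sets \<mu>"
    using C(1) s by simp
  then have "(\<integral>x. indicator C x \<partial>\<mu>) \<le> (\<integral>x. f x \<partial>\<mu>)"
    using int_f[OF \<mu>(1)] ge by (intro integral_mono) (auto simp: emeasure_eq_measure)
  then have lower: "a < (\<integral>x. f x \<partial>\<mu>)"
    using aC \<open>C \<in> sets \<mu>\<close> by simp
  let ?T = "{\<nu>\<in>M. (\<integral>x. f x \<partial>\<nu>) \<in> {a<..}}"
  have "openin (weak_star_topology M) ?T"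
    unfolding weak_star_topology_def using cont
    by (intro topology_generated_by_Basis) (use open_greaterThan in blast)
  moreover have "\<mu> \<in> ?T"
    using lower \<mu>(1) by simp
  moreover have "?T \<subseteq> {\<mu>\<in>M. a < measure \<mu> A}"
    using upper by force
  ultimately show "\<exists>T. openin (weak_star_topology M) T \<and> \<mu> \<in> T \<and> T \<subseteq> {\<mu>\<in>M. a < measure \<mu> A}"
    by (intro exI[of _ ?T] conjI)
qed

lemma topspace_weak_star_topology: "topspace (weak_star_topology M) = M"
proof -
  have "M \<in> {{\<mu>\<in>M. (\<integral>x. f x \<partial>\<mu>) \<in> V} | f V. continuous_on UNIV (f :: 'a \<Rightarrow> real) \<and> open V}"
    by (intro CollectI exI[of _ "\<lambda>_. 0"] exI[of _ UNIV]) simp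
  then show ?thesis
    unfolding weak_star_topology_def topology_generated_by_topspace by blast
qed

text \<open>Points are grouped by the set of cover elements containing them.  This makes the infimum that
  defines the entropy of a cover one over a non-empty set.\<close>

lemma borel_cover_imp_finer_partition:
  fixes \<U> :: "'x::topological_space set set"
  assumes "borel_cover \<U>"
  shows "\<exists>\<alpha>. borel_partition \<alpha> \<and> finer \<alpha> \<U>"
proof -
  have fin: "finite \<U>" and meas: "\<And>U. U \<in> \<U> \<Longrightarrow> U \<in> sets borel" and cov: "\<Union>\<U> = UNIV"
    using assms by (auto simp: borel_cover_def)
  define cell where "cell S = {x. \<forall>U\<in>\<U>. x \<in> U \<longleftrightarrow> U \<in> S}" for S
  define \<alpha> where "\<alpha> = cell ` Pow \<U>"
  have "cell S \<in> sets borel" for S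
  proof -
    have "cell S = {x \<in> space borel. \<forall>U\<in>\<U>. x \<in> U \<longleftrightarrow> U \<in> S}"
      by (simp add: cell_def)
    also have "\<dots> \<in> sets borel"
      using fin
    proof (rule sets.sets_Collect_finite_All[rotated])
      fix U assume U: "U \<in> \<U>"
      have "{x \<in> space borel. x \<in> U \<longleftrightarrow> U \<in> S} = (if U \<in> S then U else - U)"
        by auto
      then show "{x \<in> space borel. x \<in> U \<longleftrightarrow> U \<in> S} \<in> sets borel"
        using meas[OF U] by (simp add: borel_comp)
    qed
    finally show ?thesis .
  qed
  moreover have "\<Union>\<alpha> = UNIV"
  proof -
    have "x \<in> \<Union>\<alpha>" for x
    proof (rule UnionI)
      show "cell {U \<in> \<U>. x \<in> U} \<in> \<alpha>"
        unfolding \<alpha>_def by (intro imageI) simp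
      show "x \<in> cell {U \<in> \<U>. x \<in> U}"
        by (simp add: cell_def)
    qed
    then show ?thesis
      by (intro equalityI subset_UNIV subsetI)
  qed
  moreover have "disjoint \<alpha>"
  proof (rule disjointI)
    fix A B assume "A \<in> \<alpha>" "B \<in> \<alpha>" and ne: "A \<noteq> B"
    then obtain S T where "S \<subseteq> \<U>" "T \<subseteq> \<U>" "A = cell S" "B = cell T"
      unfolding \<alpha>_def by (elim imageE) simp
    moreover from this ne have "S \<noteq> T"
      by auto
    ultimately show "A \<inter> B = {}"
      unfolding cell_def by blast
  qed
  ultimately have "borel_partition \<alpha>"
    using fin by (auto simp: borel_partition_def borel_cover_def \<alpha>_def)
  moreover have "finer \<alpha> \<U>"
    unfolding finer_def
  proof
    fix A assume "A \<in> \<alpha>"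
    then obtain S where S: "S \<subseteq> \<U>" "A = cell S"
      unfolding \<alpha>_def by (elim imageE) simp
    show "\<exists>V\<in>\<U>. A \<subseteq> V"
    proof (cases "S = {}")
      case True
      have "x \<notin> A" for x
      proof
        assume "x \<in> A"
        moreover obtain U where "U \<in> \<U>" "x \<in> U"
          by (rule UnionE[of x \<U>]) (simp_all add: cov)
        ultimately show False
          using S(2) True by (simp add: cell_def)
      qed
      moreover obtain V where "V \<in> \<U>"
        by (rule UnionE[of undefined \<U>]) (simp_all add: cov)
      ultimately show ?thesis
        by blast
    next
      case False
      then obtain V where V: "V \<in> S" "V \<in> \<U>"
        using S(1) by blast
      then have "A \<subseteq> V"
        using S(2) by (auto simp: cell_def)
      then show ?thesis
        using V(2) by blast
    qed
  qed
  ultimately show ?thesis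
    by blast
qed

section \<open>Translates of a finite set in a group\<close>

context group
begin

lemma mem_r_coset_iff:
  assumes "K \<subseteq> carrier G" "g \<in> carrier G"
  shows "f \<in> K #> g \<longleftrightarrow> (\<exists>k\<in>K. f = k \<otimes> g)"
  by (auto simp: r_coset_def)

lemma mem_inv_mult_iff:
  assumes "K \<subseteq> carrier G" "F \<subseteq> carrier G"
  shows "g \<in> set_inv K <#> F \<longleftrightarrow> g \<in> carrier G \<and> (\<exists>k\<in>K. k \<otimes> g \<in> F)"
proof
  assume "g \<in> set_inv K <#> F"
  then obtain k f where kf: "k \<in> K" "f \<in> F" "g = inv k \<otimes> f"
    by (auto simp: set_mult_def SET_INV_def)
  then have carr: "k \<in> carrier G" "f \<in> carrier G"
    using assms by auto
  then have "k \<otimes> g \<in> F" "g \<in> carrier G"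
    using kf(2) by (simp_all add: kf(3) flip: m_assoc)
  then show "g \<in> carrier G \<and> (\<exists>k\<in>K. k \<otimes> g \<in> F)"
    using kf(1) by blast
next
  assume "g \<in> carrier G \<and> (\<exists>k\<in>K. k \<otimes> g \<in> F)"
  then obtain k where k: "k \<in> K" "k \<otimes> g \<in> F" "g \<in> carrier G"
    by blast
  then have "inv k \<otimes> (k \<otimes> g) = g"
    using assms(1) by (simp add: subset_iff m_assoc[symmetric])
  moreover have "inv k \<otimes> (k \<otimes> g) \<in> set_inv K <#> F"
    using k unfolding set_mult_def SET_INV_def by blast
  ultimately show "g \<in> set_inv K <#> F"
    by metis
qed

text \<open>The translates $Kg$ containing $f$ are those with $g = k^{-1} f$ for some $k \<in> K$.\<close>

lemma card_translates_containing:
  assumes K: "K \<subseteq> carrier G" "finite K" and F: "F \<subseteq> carrier G" and f: "f \<in> F"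
  shows "card {g \<in> set_inv K <#> F. f \<in> K #> g} = card K"
proof -
  have fG: "f \<in> carrier G"
    using F f by blast
  have "{g \<in> set_inv K <#> F. f \<in> K #> g} = (\<lambda>k. inv k \<otimes> f) ` K"
  proof (intro equalityI subsetI)
    fix g assume "g \<in> {g \<in> set_inv K <#> F. f \<in> K #> g}"
    then have "g \<in> carrier G" "f \<in> K #> g"
      using mem_inv_mult_iff[OF K(1) F] by auto
    then obtain k where "k \<in> K" "f = k \<otimes> g"
      using mem_r_coset_iff[OF K(1)] by auto
    then show "g \<in> (\<lambda>k. inv k \<otimes> f) ` K"
      using K(1) \<open>g \<in> carrier G\<close> by (auto simp: subset_iff m_assoc[symmetric] image_iff intro!: bexI[of _ k])
  next
    fix g assume "g \<in> (\<lambda>k. inv k \<otimes> f) ` K"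
    then obtain k where k: "k \<in> K" "g = inv k \<otimes> f"
      by blast
    then have kg: "k \<otimes> g = f" "g \<in> carrier G"
      using K(1) fG by (auto simp: subset_iff m_assoc[symmetric])
    then show "g \<in> {g \<in> set_inv K <#> F. f \<in> K #> g}"
      using k(1) f mem_inv_mult_iff[OF K(1) F, of g] mem_r_coset_iff[OF K(1) kg(2), of f]
      by (metis (mono_tags, lifting) mem_Collect_eq)
  qed
  moreover have "inj_on (\<lambda>k. inv k \<otimes> f) K"
    using K(1) fG by (intro inj_onI) (metis inv_closed inv_inv right_cancel subsetD)
  ultimately show ?thesis
    by (simp add: card_image)
qed

text \<open>Those $g \<in> K^{-1}F$ outside the $K$-boundary satisfy $Kg \<subseteq> F$, so a fixed $k \<in> K$ maps
  them injectively into $F$.\<close>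

lemma card_inv_mult_le:
  assumes K: "K \<subseteq> carrier G" "K \<noteq> {}" "finite K" and F: "F \<subseteq> carrier G" "finite F"
  shows "card (set_inv K <#> F)
    \<le> card F + card ((set_inv K <#> F) \<inter> (set_inv K <#> (carrier G - F)))"
proof -
  let ?A = "set_inv K <#> F" and ?B = "set_inv K <#> (carrier G - F)"
  obtain k where k: "k \<in> K"
    using K by blast
  have fin: "finite ?A"
    using K F by (auto simp: set_mult_def SET_INV_def)
  have "k \<otimes> g \<in> F" if "g \<in> ?A - ?B" for g
    using that k K(1) mem_inv_mult_iff[OF K(1) F(1), of g]
      mem_inv_mult_iff[OF K(1) Diff_subset, of g F] by auto
  moreover have "inj_on (\<lambda>g. k \<otimes> g) (?A - ?B)"
    using k K(1) mem_inv_mult_iff[OF K(1) F(1)] by (auto simp: inj_on_def subset_iff)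
  ultimately have "card (?A - ?B) \<le> card F"
    using F(2) by (intro card_inj_on_le[of "\<lambda>g. k \<otimes> g"]) auto
  moreover have "card ?A = card (?A - ?B) + card (?A \<inter> ?B)"
    using fin by (subst card_Un_disjoint[symmetric]) (auto intro!: arg_cong[where f = card])
  ultimately show ?thesis
    by simp
qed

end

section \<open>Mean entropy of a partition as an infimum\<close>

lemma folner_sequence_finite:
  assumes "folner_sequence G F"
  shows "F n \<subseteq> carrier G" "finite (F n)" "F n \<noteq> {}"
  using conjunct1[OF assms[unfolded folner_sequence_def]] by simp_all

text \<open>Partitions given by labels rather than as sets of sets, so that perturbed partitions keep
  the labels of the original one even if some of their elements become empty.\<close>

definition indexed_borel_partition :: "'i set \<Rightarrow> ('i \<Rightarrow> 'x::topological_space set) \<Rightarrow> bool" where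
  "indexed_borel_partition I B \<longleftrightarrow> finite I \<and> (\<forall>a\<in>I. B a \<in> sets borel) \<and>
     disjoint_family_on B I \<and> (\<Union>a\<in>I. B a) = UNIV"

lemma indexed_borel_partition_self:
  assumes "borel_partition \<alpha>"
  shows "indexed_borel_partition \<alpha> (\<lambda>A. A)"
  using assms unfolding borel_partition_def borel_cover_def indexed_borel_partition_def
  by (simp add: disjoint_family_on_def disjoint_def subset_iff)

lemma borel_partition_image:
  assumes "indexed_borel_partition I B"
  shows "borel_partition (B ` I)"
  using assms unfolding borel_partition_def borel_cover_def indexed_borel_partition_def
  by (metis (no_types, lifting) disjoint_family_on_disjoint_image finite_imageI image_subsetI)

text \<open>The join is a set of sets, in which equal atoms of different labellings are merged.  Atoms of different
  labellings are disjoint, so only empty atoms are merged, and these contribute nothing.\<close>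

lemma entropy_partition_dyn_join:
  assumes B: "indexed_borel_partition I B" and F: "finite F"
  shows "entropy_partition \<mu> (dyn_join \<phi> F (B ` I)) = joint_entropy \<mu> I (\<lambda>g a. \<phi> g -` B a) F"
proof -
  let ?atom = "\<lambda>c. \<Inter>g\<in>F. \<phi> g -` B (c g)"
  have join: "dyn_join \<phi> F (B ` I) = ?atom ` PiE F (\<lambda>_. I)"
  proof (intro equalityI subsetI)
    fix A assume "A \<in> dyn_join \<phi> F (B ` I)"
    then obtain c where c: "A = (\<Inter>g\<in>F. \<phi> g -` c g)" "\<forall>g\<in>F. c g \<in> B ` I"
      unfolding dyn_join_def by (elim CollectE exE conjE) (rule that)
    from c(2) have "\<forall>g\<in>F. \<exists>a. a \<in> I \<and> c g = B a"
      by auto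
    from bchoice[OF this] obtain d where d: "\<forall>g\<in>F. d g \<in> I \<and> c g = B (d g)" ..
    show "A \<in> ?atom ` PiE F (\<lambda>_. I)"
    proof (rule image_eqI)
      show "restrict d F \<in> PiE F (\<lambda>_. I)"
        using d by simp
      show "A = ?atom (restrict d F)"
        unfolding c(1) using d by (intro INF_cong) auto
    qed
  next
    fix A assume "A \<in> ?atom ` PiE F (\<lambda>_. I)"
    then obtain c where "A = ?atom c" "c \<in> PiE F (\<lambda>_. I)"
      by (rule imageE)
    then show "A \<in> dyn_join \<phi> F (B ` I)"
      unfolding dyn_join_def by (intro CollectI exI[of _ "\<lambda>g. B (c g)"]) auto
  qed
  have null: "entropy_term (measure \<mu> (?atom c)) = 0"
    if c: "c \<in> PiE F (\<lambda>_. I)" and d: "d \<in> PiE F (\<lambda>_. I)" and "c \<noteq> d" and eq: "?atom c = ?atom d"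
    for c d
  proof -
    obtain g where g: "g \<in> F" "c g \<noteq> d g"
      using PiE_ext[OF c d] \<open>c \<noteq> d\<close> by blast
    then have "B (c g) \<inter> B (d g) = {}"
      using B c d by (auto simp: indexed_borel_partition_def disjoint_family_on_def PiE_def Pi_def)
    moreover have "?atom c \<subseteq> \<phi> g -` B (c g)" "?atom d \<subseteq> \<phi> g -` B (d g)"
      using g(1) by (auto intro: INF_lower)
    then have "?atom c \<subseteq> \<phi> g -` (B (c g) \<inter> B (d g))"
      unfolding eq vimage_Int by (rule Int_greatest)
    ultimately have "?atom c = {}"
      by simp
    then show ?thesis
      by simp
  qed
  have "finite (PiE F (\<lambda>_. I))"
    using B F by (intro finite_PiE) (auto simp: indexed_borel_partition_def)
  then have "(\<Sum>A\<in>?atom ` PiE F (\<lambda>_. I). entropy_term (measure \<mu> A))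
      = (\<Sum>c\<in>PiE F (\<lambda>_. I). entropy_term (measure \<mu> (?atom c)))"
    by (subst sum.reindex_nontrivial) (simp_all add: null)
  then show ?thesis
    by (simp only: entropy_partition_def joint_entropy_def join entropy_term_def)
qed

context G_system
begin

sublocale group G
  by (rule group_hom[THEN group_hom.axioms(1)])

lemma continuous_map_action:
  assumes "g \<in> carrier G"
  shows "continuous_on UNIV (\<phi> g)"
proof -
  have "continuous_map euclidean (prod_topology (discrete_topology (carrier G)) euclidean)
      (\<lambda>x. (g, x))"
    using assms by (intro continuous_map_pairedI) auto
  from continuous_map_compose[OF this continuous_action] show ?thesis
    by (simp add: comp_def)
qed

lemma measurable_action [measurable]:
  assumes "g \<in> carrier G"
  shows "\<phi> g \<in> borel_measurable borel"
  using continuous_map_action[OF assms] by (rule borel_measurable_continuous_onI)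

lemma invariant_measuresD:
  assumes "\<mu> \<in> invariant_measures G \<phi>"
  shows "prob_space \<mu>" "sets \<mu> = sets borel" "space \<mu> = UNIV"
    and "g \<in> carrier G \<Longrightarrow> A \<in> sets borel \<Longrightarrow> measure \<mu> (\<phi> g -` A) = measure \<mu> A"
proof -
  show "prob_space \<mu>" and sets: "sets \<mu> = sets borel"
    using assms by (auto simp: invariant_measures_def)
  then show space: "space \<mu> = UNIV"
    using sets_eq_imp_space_eq by fastforce
  assume g: "g \<in> carrier G" and A: "A \<in> sets borel"
  have "\<phi> g \<in> measurable \<mu> borel"
    using measurable_action[OF g] measurable_cong_sets[OF sets refl] by blast
  then have "measure (distr \<mu> borel (\<phi> g)) A = measure \<mu> (\<phi> g -` A)"
    using A by (simp add: measure_distr space)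
  then show "measure \<mu> (\<phi> g -` A) = measure \<mu> A"
    using assms g by (simp add: invariant_measures_def)
qed

lemma finite_partition_family_action:
  assumes "\<mu> \<in> invariant_measures G \<phi>" "indexed_borel_partition I B"
  shows "finite_partition_family \<mu> I (\<lambda>g a. \<phi> g -` B a) (carrier G)"
proof -
  interpret prob_space \<mu>
    by (rule invariant_measuresD(1)[OF assms(1)])
  show ?thesis
  proof
    show "\<phi> g -` B a \<in> sets \<mu>" if "g \<in> carrier G" "a \<in> I" for g a
      using measurable_sets[OF measurable_action[OF that(1)], of "B a"] assms(2) that(2)
      by (simp add: invariant_measuresD(2)[OF assms(1)] indexed_borel_partition_def)
    show "disjoint_family_on (\<lambda>a. \<phi> g -` B a) I" for g
      using assms(2) by (auto simp: indexed_borel_partition_def disjoint_family_on_def)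
    show "(\<Union>a\<in>I. \<phi> g -` B a) = UNIV" for g
      using assms(2) by (simp add: indexed_borel_partition_def flip: vimage_UN)
  qed (use assms invariant_measuresD(3) in \<open>auto simp: indexed_borel_partition_def\<close>)
qed

text \<open>The atom over $Sg$ with the labels moved along is the preimage under $g$ of the atom over $S$.\<close>

lemma joint_entropy_r_coset:
  assumes \<mu>: "\<mu> \<in> invariant_measures G \<phi>" and B: "indexed_borel_partition I B"
    and S: "S \<subseteq> carrier G" "finite S" and g: "g \<in> carrier G"
  shows "joint_entropy \<mu> I (\<lambda>g a. \<phi> g -` B a) (S #> g) = joint_entropy \<mu> I (\<lambda>g a. \<phi> g -` B a) S"
proof -
  interpret finite_partition_family \<mu> I "\<lambda>g a. \<phi> g -` B a" "carrier G"
    by (rule finite_partition_family_action[OF \<mu> B])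
  have "S #> g = (\<lambda>s. s \<otimes> g) ` S"
    by (auto simp: r_coset_def)
  moreover have "inj_on (\<lambda>s. s \<otimes> g) S"
    using S(1) g by (auto simp: inj_on_def subset_iff)
  moreover have "measure \<mu> (\<Inter>s\<in>S. \<phi> (s \<otimes> g) -` B (c s)) = measure \<mu> (\<Inter>s\<in>S. \<phi> s -` B (c s))"
    if c: "c \<in> PiE S (\<lambda>_. I)" for c
  proof -
    have "(\<Inter>s\<in>S. \<phi> (s \<otimes> g) -` B (c s)) = \<phi> g -` (\<Inter>s\<in>S. \<phi> s -` B (c s))"
    proof -
      have "\<phi> (s \<otimes> g) -` B (c s) = \<phi> g -` (\<phi> s -` B (c s))" if "s \<in> S" for s
        using that S(1) g by (auto simp: composition_rule subset_iff)
      then show ?thesis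
        by (simp add: vimage_INT)
    qed
    then show ?thesis
      using invariant_measuresD(4)[OF \<mu> g] sets_atom[OF S(2,1) c]
        invariant_measuresD(2)[OF \<mu>] by simp
  qed
  ultimately show ?thesis
    by (simp only: joint_entropy_reindex) (simp add: joint_entropy_def cong: sum.cong)
qed

text \<open>Shearer's inequality for the translates $Kg$ with $g \<in> K^{-1}F$, which are the translates
  meeting $F$.\<close>

lemma joint_entropy_le_covering:
  assumes \<mu>: "\<mu> \<in> invariant_measures G \<phi>" and B: "indexed_borel_partition I B"
    and K: "K \<subseteq> carrier G" "finite K" and F: "F \<subseteq> carrier G" "finite F"
  shows "real (card K) * joint_entropy \<mu> I (\<lambda>g a. \<phi> g -` B a) F
    \<le> real (card (set_inv K <#> F)) * joint_entropy \<mu> I (\<lambda>g a. \<phi> g -` B a) K"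
proof -
  interpret finite_partition_family \<mu> I "\<lambda>g a. \<phi> g -` B a" "carrier G"
    by (rule finite_partition_family_action[OF \<mu> B])
  let ?H = "joint_entropy \<mu> I (\<lambda>g a. \<phi> g -` B a)"
  let ?J = "set_inv K <#> F"
  have J: "finite ?J"
    using K F by (auto simp: set_mult_def SET_INV_def)
  have "real (card K) * ?H F \<le> (\<Sum>j\<in>?J. ?H ((K #> j) \<inter> F))"
    using J F card_translates_containing[OF K F(1)] by (intro shearer_inequality) auto
  also have "\<dots> \<le> (\<Sum>j\<in>?J. ?H K)"
  proof (rule sum_mono)
    fix j assume "j \<in> ?J"
    then have j: "j \<in> carrier G"
      using mem_inv_mult_iff[OF K(1) F(1)] by blast
    have "?H ((K #> j) \<inter> F) \<le> ?H (K #> j)"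
      using K j r_coset_subset_G[OF K(1) j] by (intro joint_entropy_mono) (auto simp: r_coset_def)
    then show "?H ((K #> j) \<inter> F) \<le> ?H K"
      using joint_entropy_r_coset[OF \<mu> B K j] by simp
  qed
  finally show ?thesis
    by simp
qed

definition entropy_infimum :: "'x measure \<Rightarrow> 'i set \<Rightarrow> ('i \<Rightarrow> 'x set) \<Rightarrow> real" where
  "entropy_infimum \<mu> I B =
     (INF K\<in>{K. K \<subseteq> carrier G \<and> finite K \<and> K \<noteq> {}}.
        joint_entropy \<mu> I (\<lambda>g a. \<phi> g -` B a) K / real (card K))"

lemma bdd_below_entropy_ratios:
  assumes "\<mu> \<in> invariant_measures G \<phi>" "indexed_borel_partition I B"
  shows "bdd_below ((\<lambda>K. joint_entropy \<mu> I (\<lambda>g a. \<phi> g -` B a) K / real (card K)) ` \<K>)"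
proof -
  interpret finite_partition_family \<mu> I "\<lambda>g a. \<phi> g -` B a" "carrier G"
    by (rule finite_partition_family_action[OF assms])
  show ?thesis
    by (rule bdd_belowI2[of _ 0]) (simp add: joint_entropy_nonneg)
qed

text \<open>The infimum is a lower bound at every index.  For the upper bound, a set $K$ with ratio $q$ close to the
  infimum bounds the ratios along the sequence by $(1+\<delta>) q$ eventually.\<close>

lemma joint_entropy_tendsto_infimum:
  assumes \<mu>: "\<mu> \<in> invariant_measures G \<phi>" and B: "indexed_borel_partition I B"
    and F: "folner_sequence G F"
  shows "(\<lambda>n. joint_entropy \<mu> I (\<lambda>g a. \<phi> g -` B a) (F n) / real (card (F n)))
    \<longlonglongrightarrow> entropy_infimum \<mu> I B"
proof (rule order_tendstoI)
  interpret finite_partition_family \<mu> I "\<lambda>g a. \<phi> g -` B a" "carrier G"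
    by (rule finite_partition_family_action[OF \<mu> B])
  let ?H = "joint_entropy \<mu> I (\<lambda>g a. \<phi> g -` B a)"
  let ?\<K> = "{K. K \<subseteq> carrier G \<and> finite K \<and> K \<noteq> {}}"
  have Fn: "F n \<in> ?\<K>" for n
    using folner_sequence_finite[OF F] by simp
  show "\<forall>\<^sub>F n in sequentially. l < ?H (F n) / real (card (F n))" if "l < entropy_infimum \<mu> I B" for l
  proof (rule always_eventually, rule allI)
    fix n
    have "entropy_infimum \<mu> I B \<le> ?H (F n) / real (card (F n))"
      unfolding entropy_infimum_def by (rule cINF_lower[OF bdd_below_entropy_ratios[OF \<mu> B] Fn])
    then show "l < ?H (F n) / real (card (F n))"
      using that by simp
  qed
  fix u assume u: "entropy_infimum \<mu> I B < u"
  have "?\<K> \<noteq> {}"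
    using Fn[of 0] by (metis empty_iff)
  from iffD1[OF cINF_less_iff[OF this bdd_below_entropy_ratios[OF \<mu> B]] u[unfolded entropy_infimum_def]]
  obtain K where "K \<in> ?\<K>" and less: "?H K / real (card K) < u" ..
  then have K: "K \<subseteq> carrier G" "finite K" "K \<noteq> {}"
    by simp_all
  define q where "q = ?H K / real (card K)"
  \<comment> \<open>The summand 1 keeps the denominator positive and makes \<open>(1 + \<delta>) * q < u\<close> strict.\<close>
  define \<delta> where "\<delta> = (u - q) / (q + 1)"
  have q: "0 \<le> q" "q < u"
    using less joint_entropy_nonneg by (auto simp: q_def)
  then have \<delta>: "0 < \<delta>"
    by (simp add: \<delta>_def)
  have "\<delta> * q < u - q"
    using q by (simp add: \<delta>_def field_simps)
  then have bound: "(1 + \<delta>) * q < u"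
    by (simp add: algebra_simps)
  have "\<forall>\<^sub>F n in sequentially.
      real (card ((set_inv K <#> F n) \<inter> (set_inv K <#> (carrier G - F n)))) < \<delta> * real (card (F n))"
    using conjunct2[OF F[unfolded folner_sequence_def]] K \<delta> by simp
  then show "\<forall>\<^sub>F n in sequentially. ?H (F n) / real (card (F n)) < u"
  proof eventually_elim
    case (elim n)
    have n: "F n \<subseteq> carrier G" "finite (F n)" "F n \<noteq> {}"
      using Fn[of n] by auto
    have pos: "0 < real (card (F n))" "0 < real (card K)"
      using n K by (auto simp: card_gt_0_iff)
    have "real (card (set_inv K <#> F n)) \<le> (1 + \<delta>) * real (card (F n))"
      using card_inv_mult_le[OF K(1,3,2) n(1,2)] elim by (simp add: algebra_simps)
    then have "real (card (set_inv K <#> F n)) * ?H K \<le> (1 + \<delta>) * real (card (F n)) * ?H K"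
      using joint_entropy_nonneg by (intro mult_right_mono) auto
    then have "real (card K) * ?H (F n) \<le> (1 + \<delta>) * real (card (F n)) * ?H K"
      using joint_entropy_le_covering[OF \<mu> B K(1,2) n(1,2)] by linarith
    then have "?H (F n) / real (card (F n)) \<le> (1 + \<delta>) * q"
      using pos by (simp add: q_def field_simps)
    then show ?case
      using bound by linarith
  qed
qed

text \<open>Amenability makes the description definite: if there were no Folner sequence at all, every number would
  satisfy the condition defining the limit.\<close>

lemma mean_entropy_partition_eq_infimum:
  assumes \<mu>: "\<mu> \<in> invariant_measures G \<phi>" and B: "indexed_borel_partition I B"
    and "amenable G"
  shows "mean_entropy_partition G \<phi> \<mu> (B ` I) = entropy_infimum \<mu> I B"
  unfolding mean_entropy_partition_def
proof (rule the_equality)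
  have eq: "1 / real (card (F n)) * entropy_partition \<mu> (dyn_join \<phi> (F n) (B ` I))
      = joint_entropy \<mu> I (\<lambda>g a. \<phi> g -` B a) (F n) / real (card (F n))"
    if "folner_sequence G F" for F n
    by (simp add: entropy_partition_dyn_join[OF B folner_sequence_finite(2)[OF that]])
  show lim: "\<forall>F. folner_sequence G F \<longrightarrow>
      (\<lambda>n. 1 / real (card (F n)) * entropy_partition \<mu> (dyn_join \<phi> (F n) (B ` I)))
        \<longlonglongrightarrow> entropy_infimum \<mu> I B"
  proof (intro allI impI)
    fix F assume F: "folner_sequence G F"
    show "(\<lambda>n. 1 / real (card (F n)) * entropy_partition \<mu> (dyn_join \<phi> (F n) (B ` I)))
        \<longlonglongrightarrow> entropy_infimum \<mu> I B"
      unfolding eq[OF F] by (rule joint_entropy_tendsto_infimum[OF \<mu> B F])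
  qed
  obtain F where F: "folner_sequence G F"
    using assms(3) unfolding amenable_def ..
  fix h
  assume h: "\<forall>F. folner_sequence G F \<longrightarrow>
      (\<lambda>n. 1 / real (card (F n)) * entropy_partition \<mu> (dyn_join \<phi> (F n) (B ` I))) \<longlonglongrightarrow> h"
  show "h = entropy_infimum \<mu> I B"
    by (rule LIMSEQ_unique[OF mp[OF spec[OF h] F] mp[OF spec[OF lim] F]])
qed

end

section \<open>Upper semicontinuity of the entropy of an open cover\<close>

context G_system
begin

lemma mean_entropy_partition_nonneg:
  assumes \<mu>: "\<mu> \<in> invariant_measures G \<phi>" and "amenable G" and \<alpha>: "borel_partition \<alpha>"
  shows "0 \<le> mean_entropy_partition G \<phi> \<mu> \<alpha>"
proof -
  have B: "indexed_borel_partition \<alpha> (\<lambda>A. A)"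
    using \<alpha> by (rule indexed_borel_partition_self)
  interpret finite_partition_family \<mu> \<alpha> "\<lambda>g A. \<phi> g -` A" "carrier G"
    by (rule finite_partition_family_action[OF \<mu> B])
  have "{\<one>} \<in> {K. K \<subseteq> carrier G \<and> finite K \<and> K \<noteq> {}}"
    by simp
  then have "0 \<le> entropy_infimum \<mu> \<alpha> (\<lambda>A. A)"
    unfolding entropy_infimum_def
    by (intro cINF_greatest) (auto simp: joint_entropy_nonneg)
  then show ?thesis
    using mean_entropy_partition_eq_infimum[OF \<mu> B \<open>amenable G\<close>] by simp
qed

lemma mean_entropy_partition_le_joint_entropy:
  assumes \<mu>: "\<mu> \<in> invariant_measures G \<phi>" and "amenable G" and B: "indexed_borel_partition I B"
    and K: "K \<subseteq> carrier G" "finite K" "K \<noteq> {}"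
  shows "mean_entropy_partition G \<phi> \<mu> (B ` I)
    \<le> joint_entropy \<mu> I (\<lambda>g a. \<phi> g -` B a) K / real (card K)"
  unfolding mean_entropy_partition_eq_infimum[OF \<mu> B \<open>amenable G\<close>] entropy_infimum_def
  using K by (intro cINF_lower[OF bdd_below_entropy_ratios[OF \<mu> B]]) simp

lemma bdd_below_mean_entropies:
  assumes "\<mu> \<in> invariant_measures G \<phi>" "amenable G"
  shows "bdd_below {mean_entropy_partition G \<phi> \<mu> \<alpha> | \<alpha>. borel_partition \<alpha> \<and> finer \<alpha> \<U>}"
  by (rule bdd_belowI[of _ 0]) (use mean_entropy_partition_nonneg[OF assms] in blast)

lemma mean_entropies_nonempty:
  assumes "borel_cover \<U>"
  shows "{mean_entropy_partition G \<phi> \<mu> \<alpha> | \<alpha>. borel_partition \<alpha> \<and> finer \<alpha> \<U>} \<noteq> {}"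
  using borel_cover_imp_finer_partition[OF assms] by blast

lemma mean_entropy_cover_nonneg:
  assumes \<mu>: "\<mu> \<in> invariant_measures G \<phi>" and "amenable G" and "borel_cover \<U>"
  shows "0 \<le> mean_entropy_cover G \<phi> \<mu> \<U>"
  unfolding mean_entropy_cover_def
  by (rule cInf_greatest[OF mean_entropies_nonempty[OF \<open>borel_cover \<U>\<close>]])
    (use mean_entropy_partition_nonneg[OF assms(1,2)] in blast)

text \<open>A point of the first atom outside the second one is moved by some $g \<in> K$ into
  $A_g \<setminus> C_g$; by invariance each such event has measure at most $r$.\<close>

lemma measure_INT_vimage_le:
  assumes \<mu>: "\<mu> \<in> invariant_measures G \<phi>"
    and K: "K \<subseteq> carrier G" "finite K"
    and sets: "\<And>g. g \<in> K \<Longrightarrow> A g \<in> sets borel" "\<And>g. g \<in> K \<Longrightarrow> C g \<in> sets borel"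
    and meas: "\<And>g. g \<in> K \<Longrightarrow> measure \<mu> (A g - C g) \<le> r"
  shows "measure \<mu> (\<Inter>g\<in>K. \<phi> g -` A g) \<le> measure \<mu> (\<Inter>g\<in>K. \<phi> g -` C g) + real (card K) * r"
proof (cases "K = {}")
  case True
  then show ?thesis
    by simp
next
  case False
  interpret prob_space \<mu>
    by (rule invariant_measuresD(1)[OF \<mu>])
  have vimage: "\<phi> g -` B \<in> sets \<mu>" if "g \<in> K" "B \<in> sets borel" for g B
    using that K(1) measurable_sets[OF measurable_action, of g B] invariant_measuresD(2)[OF \<mu>] by auto
  have diff: "\<phi> g -` (A g - C g) \<in> sets \<mu>" if "g \<in> K" for g
    using that sets by (intro vimage) auto
  have inter: "(\<Inter>g\<in>K. \<phi> g -` C g) \<in> sets \<mu>"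
    using K(2) False vimage sets(2) by (intro sets.finite_INT) auto
  have union: "(\<Union>g\<in>K. \<phi> g -` (A g - C g)) \<in> sets \<mu>"
    using K(2) diff by (intro sets.finite_UN) auto
  have "measure \<mu> (\<Inter>g\<in>K. \<phi> g -` A g)
      \<le> measure \<mu> ((\<Inter>g\<in>K. \<phi> g -` C g) \<union> (\<Union>g\<in>K. \<phi> g -` (A g - C g)))"
    using inter union by (intro finite_measure_mono sets.Un) auto
  also have "\<dots> \<le> measure \<mu> (\<Inter>g\<in>K. \<phi> g -` C g) + measure \<mu> (\<Union>g\<in>K. \<phi> g -` (A g - C g))"
    using inter union by (rule measure_Un_le)
  also have "measure \<mu> (\<Union>g\<in>K. \<phi> g -` (A g - C g)) \<le> (\<Sum>g\<in>K. measure \<mu> (\<phi> g -` (A g - C g)))"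
    using K(2) diff by (intro measure_UNION_le) auto
  also have "\<dots> \<le> (\<Sum>g\<in>K. r)"
    using K(1) sets meas invariant_measuresD(4)[OF \<mu>, of _ "A _ - C _"]
    by (intro sum_mono) (simp add: subset_iff sets.Diff)
  finally show ?thesis
    by simp
qed

text \<open>A refinement of the cover, close to the given one, whose elements contain almost all of their mass in open
  parts.  The open part $V_A$ comes from separating closed subsets of the
  elements of $\<alpha>$ and is cut down to an element of the cover.  What the open parts leave
  uncovered is distributed as in $\<alpha>$, which already refines the cover.\<close>

lemma robust_refinement:
  assumes \<mu>: "\<mu> \<in> invariant_measures G \<phi>" and \<alpha>: "borel_partition \<alpha>" and fine: "finer \<alpha> \<U>"
    and open_cover: "\<forall>U\<in>\<U>. open U" and r: "0 < r"
  obtains B V where "indexed_borel_partition \<alpha> B" "finer (B ` \<alpha>) \<U>"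
    and "\<forall>A\<in>\<alpha>. open (V A) \<and> V A \<subseteq> B A \<and> measure \<mu> (A - V A) \<le> r"
proof -
  interpret prob_space \<mu>
    by (rule invariant_measuresD(1)[OF \<mu>])
  have fin: "finite \<alpha>" and borel: "\<And>A. A \<in> \<alpha> \<Longrightarrow> A \<in> sets borel"
    and cov: "\<Union>\<alpha> = UNIV" and disj: "disjoint \<alpha>"
    using \<alpha> by (auto simp: borel_partition_def borel_cover_def)
  have "\<forall>A\<in>\<alpha>. \<exists>U. U \<in> \<U> \<and> A \<subseteq> U"
    using fine unfolding finer_def by blast
  from bchoice[OF this] obtain u where u: "\<forall>A\<in>\<alpha>. u A \<in> \<U> \<and> A \<subseteq> u A" ..
  have "\<forall>A\<in>\<alpha>. \<exists>C. closed C \<and> C \<subseteq> A \<and> measure \<mu> (A - C) < r"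
    using borel_inner_closed[OF finite_measure_axioms invariant_measuresD(2)[OF \<mu>] borel r] by simp
  from bchoice[OF this]
  obtain C where C: "\<forall>A\<in>\<alpha>. closed (C A) \<and> C A \<subseteq> A \<and> measure \<mu> (A - C A) < r" ..
  have "disjoint_family_on C \<alpha>"
    unfolding disjoint_family_on_def
  proof (intro ballI impI)
    fix A A' assume "A \<in> \<alpha>" "A' \<in> \<alpha>" "A \<noteq> A'"
    then have "A \<inter> A' = {}" "C A \<subseteq> A" "C A' \<subseteq> A'"
      using disj C by (auto simp: disjoint_def)
    then show "C A \<inter> C A' = {}"
      by blast
  qed
  then obtain W where W: "\<forall>A\<in>\<alpha>. open (W A) \<and> C A \<subseteq> W A" "disjoint_family_on W \<alpha>"
    using disjoint_closed_separation[OF fin, of C] C by auto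
  define V where "V A = W A \<inter> u A" for A
  define B where "B A = V A \<union> (A - (\<Union>A'\<in>\<alpha>. V A'))" for A
  have V_open: "open (V A)" if "A \<in> \<alpha>" for A
    using W(1) u open_cover that unfolding V_def by (intro open_Int) auto
  have V_disj: "V A \<inter> V A' = {}" if "A \<in> \<alpha>" "A' \<in> \<alpha>" "A \<noteq> A'" for A A'
    using disjoint_family_onD[OF W(2) that] unfolding V_def by blast
  show ?thesis
  proof (rule that[of B V])
    show "indexed_borel_partition \<alpha> B"
      unfolding indexed_borel_partition_def
    proof (intro conjI ballI)
      show "finite \<alpha>"
        by (rule fin)
      show "B A \<in> sets borel" if "A \<in> \<alpha>" for A
      proof -
        have "open (\<Union>A'\<in>\<alpha>. V A')"
          using V_open by blast
        then show ?thesis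
          unfolding B_def using V_open[OF that] borel[OF that] by (intro sets.Un sets.Diff) auto
      qed
      show "disjoint_family_on B \<alpha>"
        unfolding disjoint_family_on_def
      proof (intro ballI impI)
        fix A A' assume A: "A \<in> \<alpha>" "A' \<in> \<alpha>" "A \<noteq> A'"
        have "A \<inter> A' = {}"
          using disj A by (auto simp: disjoint_def)
        then show "B A \<inter> B A' = {}"
          using V_disj[OF A] A(1,2) unfolding B_def by blast
      qed
      show "(\<Union>A\<in>\<alpha>. B A) = UNIV"
      proof (rule equalityI[OF subset_UNIV subsetI])
        fix x
        obtain A where "A \<in> \<alpha>" "x \<in> A"
          by (rule UnionE[of x \<alpha>]) (simp_all add: cov)
        then show "x \<in> (\<Union>A\<in>\<alpha>. B A)"
          unfolding B_def by blast
      qed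
    qed
    show "finer (B ` \<alpha>) \<U>"
      unfolding finer_def
    proof
      fix S assume "S \<in> B ` \<alpha>"
      then obtain A where A: "A \<in> \<alpha>" "S = B A"
        by blast
      then have "u A \<in> \<U>" "S \<subseteq> u A"
        using u unfolding B_def V_def by auto
      then show "\<exists>U\<in>\<U>. S \<subseteq> U"
        by blast
    qed
    show "\<forall>A\<in>\<alpha>. open (V A) \<and> V A \<subseteq> B A \<and> measure \<mu> (A - V A) \<le> r"
    proof (intro ballI conjI)
      fix A assume A: "A \<in> \<alpha>"
      show "open (V A)"
        by (rule V_open[OF A])
      show "V A \<subseteq> B A"
        by (simp add: B_def)
      have "C A \<subseteq> V A" "closed (C A)"
        using C W(1) u A unfolding V_def by blast+
      then have "measure \<mu> (A - V A) \<le> measure \<mu> (A - C A)"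
        using borel[OF A] invariant_measuresD(2)[OF \<mu>] by (intro finite_measure_mono) auto
      then show "measure \<mu> (A - V A) \<le> r"
        using C A by (meson less_imp_le order_trans)
    qed
  qed
qed

text \<open>The bound $b$ survives on a whole weak* neighbourhood, at the price of replacing $\<alpha>$ by another
  refinement of the cover.  The neighbourhood only prescribes lower bounds for the measures of
  finitely many open sets.\<close>

lemma robust_joint_entropy_bound:
  assumes \<mu>: "\<mu> \<in> invariant_measures G \<phi>" and \<alpha>: "borel_partition \<alpha>" and fine: "finer \<alpha> \<U>"
    and open_cover: "\<forall>U\<in>\<U>. open U"
    and K: "K \<subseteq> carrier G" "finite K"
    and b: "joint_entropy \<mu> \<alpha> (\<lambda>g A. \<phi> g -` A) K < b"
  obtains B T where "indexed_borel_partition \<alpha> B" "finer (B ` \<alpha>) \<U>"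
    and "openin (weak_star_topology (invariant_measures G \<phi>)) T" "\<mu> \<in> T"
    and "\<forall>\<nu>\<in>T. joint_entropy \<nu> \<alpha> (\<lambda>g A. \<phi> g -` B A) K < b"
proof -
  let ?M = "invariant_measures G \<phi>"
  let ?N = "PiE K (\<lambda>_. \<alpha>)"
  define p where "p c = measure \<mu> (\<Inter>g\<in>K. \<phi> g -` c g)" for c
  have part: "indexed_borel_partition \<alpha> (\<lambda>A. A)"
    using \<alpha> by (rule indexed_borel_partition_self)
  interpret \<mu>: finite_partition_family \<mu> \<alpha> "\<lambda>g A. \<phi> g -` A" "carrier G"
    by (rule finite_partition_family_action[OF \<mu> part])
  have fin: "finite ?N"
    using K(2) \<mu>.finite_I by (intro finite_PiE) auto
  have sum_p: "sum p ?N = 1"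
    unfolding p_def using \<mu>.sum_measure_atoms[OF K(2,1)] .
  then have ne: "?N \<noteq> {}"
    by (metis sum.empty zero_neq_one)
  then have card_N: "0 < real (card ?N)"
    using fin by (simp add: card_gt_0_iff)
  define e where "e = b - joint_entropy \<mu> \<alpha> (\<lambda>g A. \<phi> g -` A) K"
  have "0 < e"
    using b by (simp add: e_def)
  from entropy_term_sum_near[OF fin _ this, of p] obtain \<delta> where \<delta>: "0 < \<delta>"
    "\<forall>q. (\<forall>c\<in>?N. 0 \<le> q c \<and> \<bar>q c - p c\<bar> < \<delta>) \<longrightarrow>
      (\<Sum>c\<in>?N. entropy_term (q c)) < (\<Sum>c\<in>?N. entropy_term (p c)) + e"
    by (auto simp: p_def)
  \<comment> \<open>Lower bounds up to \<open>d\<close> for all atoms give two-sided bounds up to \<open>\<delta>\<close>.\<close>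
  define d where "d = \<delta> / real (card ?N)"
  have d: "0 < d" "real (card ?N) * d = \<delta>"
    using \<delta>(1) card_N by (simp_all add: d_def)
  \<comment> \<open>An atom is an intersection over \<open>K\<close>, so it inherits the error \<open>r\<close> at most \<open>card K\<close> times;
    the summand 1 avoids a division by zero.\<close>
  define r where "r = d / (real (card K) + 1)"
  have r: "0 < r" "real (card K) * r < d"
    using d(1) by (simp_all add: r_def field_simps add_nonneg_pos)
  obtain B V where B: "indexed_borel_partition \<alpha> B" "finer (B ` \<alpha>) \<U>"
    and V_all: "\<forall>A\<in>\<alpha>. open (V A) \<and> V A \<subseteq> B A \<and> measure \<mu> (A - V A) \<le> r"
    by (rule robust_refinement[OF \<mu> \<alpha> fine open_cover r(1)])
  have V: "open (V A)" "V A \<subseteq> B A" "measure \<mu> (A - V A) \<le> r" if "A \<in> \<alpha>" for A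
    using V_all that by auto
  define open_atom where "open_atom c = (\<Inter>g\<in>K. \<phi> g -` V (c g))" for c
  define T where "T = (\<Inter>c\<in>?N. {\<nu>\<in>?M. p c - d < measure \<nu> (open_atom c)})"
  have O_open: "open (open_atom c)" if "c \<in> ?N" for c
    unfolding open_atom_def
  proof (rule open_INT[OF K(2)], rule ballI)
    fix g assume g: "g \<in> K"
    then have "c g \<in> \<alpha>" "g \<in> carrier G"
      using that K(1) by auto
    then show "open (\<phi> g -` V (c g))"
      using open_vimage[OF V(1) continuous_map_action] by blast
  qed
  have "openin (weak_star_topology ?M) T"
    unfolding T_def
  proof (rule openin_INT2[OF fin ne])
    fix c assume "c \<in> ?N"
    then show "openin (weak_star_topology ?M) {\<nu>\<in>?M. p c - d < measure \<nu> (open_atom c)}"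
      using invariant_measuresD(1,2) O_open by (intro openin_weak_star_measure_greater) auto
  qed
  moreover have "\<mu> \<in> T"
    unfolding T_def
  proof (intro INT_I CollectI conjI \<mu>)
    fix c assume c: "c \<in> ?N"
    have mem: "c g \<in> \<alpha>" if "g \<in> K" for g
      using c that by auto
    have "p c \<le> measure \<mu> (open_atom c) + real (card K) * r"
      unfolding p_def open_atom_def
    proof (rule measure_INT_vimage_le[OF \<mu> K])
      show "c g \<in> sets borel" if "g \<in> K" for g
        using mem[OF that] part by (simp add: indexed_borel_partition_def)
    qed (use mem V(1,3) in auto)
    then show "p c - d < measure \<mu> (open_atom c)"
      using r(2) by linarith
  qed
  moreover have "\<forall>\<nu>\<in>T. joint_entropy \<nu> \<alpha> (\<lambda>g A. \<phi> g -` B A) K < b"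
  proof
    fix \<nu> assume \<nu>_T: "\<nu> \<in> T"
    have \<nu>: "\<nu> \<in> ?M" and lower: "\<And>c. c \<in> ?N \<Longrightarrow> p c - d < measure \<nu> (open_atom c)"
      using \<nu>_T ne unfolding T_def by blast+
    interpret \<nu>: finite_partition_family \<nu> \<alpha> "\<lambda>g A. \<phi> g -` B A" "carrier G"
      by (rule finite_partition_family_action[OF \<nu> B(1)])
    define q where "q c = measure \<nu> (\<Inter>g\<in>K. \<phi> g -` B (c g))" for c
    have sum_q: "sum q ?N = 1"
      unfolding q_def using \<nu>.sum_measure_atoms[OF K(2,1)] .
    have lower_q: "p c - d < q c" if c: "c \<in> ?N" for c
    proof -
      have "open_atom c \<subseteq> (\<Inter>g\<in>K. \<phi> g -` B (c g))"
        unfolding open_atom_def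
      proof (rule INF_mono)
        fix g assume g: "g \<in> K"
        then have "V (c g) \<subseteq> B (c g)"
          using c V(2) by auto
        then show "\<exists>h\<in>K. \<phi> h -` V (c h) \<subseteq> \<phi> g -` B (c g)"
          using g by (intro bexI[of _ g] vimage_mono)
      qed
      then have "measure \<nu> (open_atom c) \<le> q c"
        unfolding q_def using \<nu>.sets_atom[OF K(2,1) c] by (rule \<nu>.finite_measure_mono)
      then show ?thesis
        using lower[OF c] by linarith
    qed
    have "\<bar>q c - p c\<bar> < \<delta>" if "c \<in> ?N" for c
      using equal_sum_lower_bounds_imp_close[where p = p and q = q, OF fin that _ d(1) lower_q]
        sum_p sum_q d(2) by simp
    then have "(\<Sum>c\<in>?N. entropy_term (q c)) < (\<Sum>c\<in>?N. entropy_term (p c)) + e"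
      using \<delta>(2) by (simp add: q_def)
    then show "joint_entropy \<nu> \<alpha> (\<lambda>g A. \<phi> g -` B A) K < b"
      by (simp add: e_def joint_entropy_def flip: p_def q_def)
  qed
  ultimately show ?thesis
    by (rule that[OF B])
qed

lemma upper_semicontinuous_mean_entropy_cover:
  assumes "amenable G" and \<U>: "borel_cover \<U>" and open_cover: "\<forall>U\<in>\<U>. open U"
  shows "upper_semicontinuous_map (weak_star_topology (invariant_measures G \<phi>))
    (\<lambda>\<mu>. mean_entropy_cover G \<phi> \<mu> \<U>)"
  unfolding upper_semicontinuous_map_def topspace_weak_star_topology
proof (rule allI, subst openin_subopen, rule ballI)
  let ?M = "invariant_measures G \<phi>"
  fix a \<mu> assume "\<mu> \<in> {\<mu>\<in>?M. mean_entropy_cover G \<phi> \<mu> \<U> < a}"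
  then have \<mu>: "\<mu> \<in> ?M" and less: "mean_entropy_cover G \<phi> \<mu> \<U> < a"
    by simp_all
  from less obtain h where "h \<in> {mean_entropy_partition G \<phi> \<mu> \<alpha> | \<alpha>. borel_partition \<alpha> \<and> finer \<alpha> \<U>}" "h < a"
    unfolding mean_entropy_cover_def
      cInf_less_iff[OF mean_entropies_nonempty[OF \<U>] bdd_below_mean_entropies[OF \<mu> \<open>amenable G\<close>]] ..
  then obtain \<alpha> where \<alpha>: "borel_partition \<alpha>" "finer \<alpha> \<U>" "mean_entropy_partition G \<phi> \<mu> \<alpha> < a"
    by blast
  have part: "indexed_borel_partition \<alpha> (\<lambda>A. A)"
    using \<alpha>(1) by (rule indexed_borel_partition_self)
  have inf_less: "entropy_infimum \<mu> \<alpha> (\<lambda>A. A) < a"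
    using \<alpha>(3) mean_entropy_partition_eq_infimum[OF \<mu> part \<open>amenable G\<close>] by simp
  have "{\<one>} \<in> {K. K \<subseteq> carrier G \<and> finite K \<and> K \<noteq> {}}"
    by simp
  then have "{K. K \<subseteq> carrier G \<and> finite K \<and> K \<noteq> {}} \<noteq> {}"
    by (metis empty_iff)
  from iffD1[OF cINF_less_iff[OF this bdd_below_entropy_ratios[OF \<mu> part]]
      inf_less[unfolded entropy_infimum_def]]
  obtain K where "K \<in> {K. K \<subseteq> carrier G \<and> finite K \<and> K \<noteq> {}}"
    and ratio: "joint_entropy \<mu> \<alpha> (\<lambda>g A. \<phi> g -` A) K / real (card K) < a" ..
  then have K: "K \<subseteq> carrier G" "finite K" "K \<noteq> {}"
    by simp_all
  then have card_K: "0 < real (card K)"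
    by (simp add: card_gt_0_iff)
  have "joint_entropy \<mu> \<alpha> (\<lambda>g A. \<phi> g -` A) K < a * real (card K)"
    using ratio card_K by (simp add: divide_less_eq)
  then obtain B T where B: "indexed_borel_partition \<alpha> B" "finer (B ` \<alpha>) \<U>"
    and T: "openin (weak_star_topology ?M) T" "\<mu> \<in> T"
      "\<forall>\<nu>\<in>T. joint_entropy \<nu> \<alpha> (\<lambda>g A. \<phi> g -` B A) K < a * real (card K)"
    by (rule robust_joint_entropy_bound[OF \<mu> \<alpha>(1,2) open_cover K(1,2)])
  have "mean_entropy_cover G \<phi> \<nu> \<U> < a" if "\<nu> \<in> T" for \<nu>
  proof -
    have \<nu>: "\<nu> \<in> ?M"
      using openin_subset[OF T(1)] that unfolding topspace_weak_star_topology by blast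
    have "mean_entropy_cover G \<phi> \<nu> \<U> \<le> mean_entropy_partition G \<phi> \<nu> (B ` \<alpha>)"
      unfolding mean_entropy_cover_def
      by (rule cInf_lower[OF _ bdd_below_mean_entropies[OF \<nu> \<open>amenable G\<close>]])
        (use B(2) borel_partition_image[OF B(1)] in blast)
    also have "\<dots> \<le> joint_entropy \<nu> \<alpha> (\<lambda>g A. \<phi> g -` B A) K / real (card K)"
      by (rule mean_entropy_partition_le_joint_entropy[OF \<nu> \<open>amenable G\<close> B(1) K])
    also have "\<dots> < a"
      using bspec[OF T(3) that] card_K by (simp add: divide_less_eq)
    finally show ?thesis .
  qed
  moreover have "T \<subseteq> ?M"
    using openin_subset[OF T(1)] unfolding topspace_weak_star_topology .
  ultimately show "\<exists>T. openin (weak_star_topology ?M) T \<and> \<mu> \<in> T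
      \<and> T \<subseteq> {\<mu>\<in>?M. mean_entropy_cover G \<phi> \<mu> \<U> < a}"
    using T(1,2) by (intro exI[of _ T]) blast
qed

end

theorem proposition3p8:
  fixes G :: "('g, 'm) monoid_scheme"
    and \<phi> :: "'g \<Rightarrow> 'x::metric_space \<Rightarrow> 'x"
    and \<U> :: "'x set set"
  assumes "group G"
    and "countable (carrier G)"
    and "infinite (carrier G)"
    and "amenable G"
    and "G_system G \<phi>"
    and "borel_cover \<U>"
    and "\<forall>U\<in>\<U>. open U"
  shows "(\<lambda>\<mu>. mean_entropy_cover G \<phi> \<mu> \<U>) \<in> invariant_measures G \<phi> \<rightarrow> {0..}
    \<and> upper_semicontinuous_map (weak_star_topology (invariant_measures G \<phi>))
        (\<lambda>\<mu>. mean_entropy_cover G \<phi> \<mu> \<U>)"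
proof -
  interpret G_system G \<phi>
    by fact
  show ?thesis
    using mean_entropy_cover_nonneg[OF _ \<open>amenable G\<close> \<open>borel_cover \<U>\<close>]
      upper_semicontinuous_mean_entropy_cover[OF \<open>amenable G\<close> \<open>borel_cover \<U>\<close>] assms(7)
    by simp
qed

end
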